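(* Let $(\mathbb{R},r)$ be the terminal object of the category $\mathbf{NAS}_\bullet$ of pointed non-anomalous semigroups. Then $(\mathbb{R},r)$ has an associated field structure. In other words, if we choose some element $1\in\mathbb{R}$ (not the additive identity), then there is a unique choice of product on $\mathbb{R}$ which has identity $1$, and this is automatically a field. Furthermore, $\mathbb{R}$ is the terminal object in the category $\mathbf{AF}$ of Archimedean fields.
   Context: Here $\mathbb{R}$ is defined only as the totally ordered semigroup (written additively) underlying the terminal object of $\mathbf{NAS}_\bullet$ (which exists and is unique up to isomorphism), not by a classical construction. It is a totally ordered group. A totally ordered semigroup is a set $S$ with a binary relation $<$ and an operation $+$ (not assumed commutative) such that for all $x,y,z\in S$: (1) $x<y$ and $y<z$ imply $x<z$; (2) exactly one of $x<y$, $x=y$, $x>y$ holds; (3) $(x+y)+z=x+(y+z)$; (4) $x<y$ implies $x+z<y+z$ and $z+x<z+y$. $\mathbb{N}=\{1,2,3,\dots\}$ and $nx$ is the $n$-fold sum. Elements $x>y$ form an anomalous pair if either $nx<(n+1)y$ for every $n\in\mathbb{N}$, or $ny>(n+1)x$ for every $n\in\mathbb{N}$. A non-anomalous semigroup is a totally ordered semigroup with no anomalous pair. A positive (resp. negative) morphism is a map $f$ with $f(x+y)=f(x)+f(y)$ and $x<y\Rightarrow f(x)<f(y)$ (resp. $x<y\Rightarrow f(x)>f(y)$); a morphism is a positive or negative morphism. $\mathbf{NAS}_\bullet$ has as objects pairs $(A,a)$ with $A$ a non-anomalous semigroup and $a\in A$ not an identity; arrows $(A,a)\to(B,b)$ are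 morphisms $f:A\to B$ with $f(a)=b$. The dual of $A$ is $A$ with the same operation and the reversed order; every $(A,a)$ is isomorphic in $\mathbf{NAS}_\bullet$ to its dual (via the identity map of the underlying set, a negative morphism), and in this sense a basepoint may always be taken to be positive. A totally ordered group $G$ is Archimedean if for all $x,y>0$ there is $n\in\mathbb{N}$ with $x<ny$, and for all $x,y<0$ there is $n\in\mathbb{N}$ with $x>ny$. An Archimedean ring is an (associative, unital, not assumed commutative) ring whose additive group carries a total order making it an Archimedean group, such that $1\neq0$ and $a,b>0$ implies $ab>0$. An Archimedean field is an Archimedean ring in which every nonzero element is invertible. Arrows in $\mathbf{AF}$ are ring homomorphisms preserving $1$ that are morphisms (order preserving or reversing) of the underlying ordered groups. A "product on $\mathbb{R}$ with identity $1$" means a multiplication which, together with the given addition, makes $\mathbb{R}$ an Archimedean ring with multiplicative identity $1$, where the order is replaced by its dual if the chosen basepoint $1$ is negative. *)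

theory Defs
  imports "HOL-Algebra.Ring" "HOL-Library.FuncSet"
begin

section \<open>Totally ordered semigroups\<close>

record 'a osemigroup = "'a partial_object" +
  sadd :: "'a \<Rightarrow> 'a \<Rightarrow> 'a" (infixl "\<boxplus>\<index>" 65)
  sless :: "'a \<Rightarrow> 'a \<Rightarrow> bool" (infix "\<prec>\<index>" 50)

locale totally_ordered_semigroup =
  fixes A :: "'a osemigroup" (structure)
  assumes closed: "\<lbrakk>x \<in> carrier A; y \<in> carrier A\<rbrakk> \<Longrightarrow> x \<boxplus> y \<in> carrier A"
    and less_trans: "\<lbrakk>x \<in> carrier A; y \<in> carrier A; z \<in> carrier A; x \<prec> y; y \<prec> z\<rbrakk> \<Longrightarrow> x \<prec> z"
    and trichotomy: "\<lbrakk>x \<in> carrier A; y \<in> carrier A\<rbrakk> \<Longrightarrow>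
      (x \<prec> y \<and> x \<noteq> y \<and> \<not> y \<prec> x) \<or>
      (\<not> x \<prec> y \<and> x = y \<and> \<not> y \<prec> x) \<or>
      (\<not> x \<prec> y \<and> x \<noteq> y \<and> y \<prec> x)"
    and assoc: "\<lbrakk>x \<in> carrier A; y \<in> carrier A; z \<in> carrier A\<rbrakk> \<Longrightarrow>
      (x \<boxplus> y) \<boxplus> z = x \<boxplus> (y \<boxplus> z)"
    and add_mono_right: "\<lbrakk>x \<in> carrier A; y \<in> carrier A; z \<in> carrier A; x \<prec> y\<rbrakk> \<Longrightarrow>
      x \<boxplus> z \<prec> y \<boxplus> z"
    and add_mono_left: "\<lbrakk>x \<in> carrier A; y \<in> carrier A; z \<in> carrier A; x \<prec> y\<rbrakk> \<Longrightarrow>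
      z \<boxplus> x \<prec> z \<boxplus> y"

text \<open>The \<open>n\<close>-fold sum is meaningful for \<open>n \<ge> 1\<close> only, as there need not be an identity;
  every use below is guarded accordingly.\<close>

definition nsum :: "'a osemigroup \<Rightarrow> nat \<Rightarrow> 'a \<Rightarrow> 'a" where
  "nsum A n x = ((\<lambda>y. y \<boxplus>\<^bsub>A\<^esub> x) ^^ (n - 1)) x"

definition anomalous_pair :: "'a osemigroup \<Rightarrow> 'a \<Rightarrow> 'a \<Rightarrow> bool" where
  "anomalous_pair A x y \<longleftrightarrow>
     x \<in> carrier A \<and> y \<in> carrier A \<and> y \<prec>\<^bsub>A\<^esub> x \<and>
     ((\<forall>n\<ge>1. nsum A n x \<prec>\<^bsub>A\<^esub> nsum A (n + 1) y) \<or>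
      (\<forall>n\<ge>1. nsum A (n + 1) x \<prec>\<^bsub>A\<^esub> nsum A n y))"

definition non_anomalous_semigroup :: "'a osemigroup \<Rightarrow> bool" where
  "non_anomalous_semigroup A \<longleftrightarrow>
     totally_ordered_semigroup A \<and> (\<nexists>x y. anomalous_pair A x y)"

definition is_identity :: "'a osemigroup \<Rightarrow> 'a \<Rightarrow> bool" where
  "is_identity A e \<longleftrightarrow>
     e \<in> carrier A \<and> (\<forall>x\<in>carrier A. e \<boxplus>\<^bsub>A\<^esub> x = x \<and> x \<boxplus>\<^bsub>A\<^esub> e = x)"

definition dual :: "'a osemigroup \<Rightarrow> 'a osemigroup" where
  "dual A = A\<lparr>sless := (\<lambda>x y. y \<prec>\<^bsub>A\<^esub> x)\<rparr>"

definition additive_map :: "'a osemigroup \<Rightarrow> 'b osemigroup \<Rightarrow> ('a \<Rightarrow> 'b) \<Rightarrow> bool" where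
  "additive_map A B f \<longleftrightarrow> f \<in> carrier A \<rightarrow> carrier B \<and>
     (\<forall>x\<in>carrier A. \<forall>y\<in>carrier A. f (x \<boxplus>\<^bsub>A\<^esub> y) = f x \<boxplus>\<^bsub>B\<^esub> f y)"

definition positive_morphism :: "'a osemigroup \<Rightarrow> 'b osemigroup \<Rightarrow> ('a \<Rightarrow> 'b) \<Rightarrow> bool" where
  "positive_morphism A B f \<longleftrightarrow> additive_map A B f \<and>
     (\<forall>x\<in>carrier A. \<forall>y\<in>carrier A. x \<prec>\<^bsub>A\<^esub> y \<longrightarrow> f x \<prec>\<^bsub>B\<^esub> f y)"

definition negative_morphism :: "'a osemigroup \<Rightarrow> 'b osemigroup \<Rightarrow> ('a \<Rightarrow> 'b) \<Rightarrow> bool" where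
  "negative_morphism A B f \<longleftrightarrow> additive_map A B f \<and>
     (\<forall>x\<in>carrier A. \<forall>y\<in>carrier A. x \<prec>\<^bsub>A\<^esub> y \<longrightarrow> f y \<prec>\<^bsub>B\<^esub> f x)"

definition morphism :: "'a osemigroup \<Rightarrow> 'b osemigroup \<Rightarrow> ('a \<Rightarrow> 'b) \<Rightarrow> bool" where
  "morphism A B f \<longleftrightarrow> positive_morphism A B f \<or> negative_morphism A B f"


section \<open>Pointed non-anomalous semigroups\<close>

definition nas_object :: "'a osemigroup \<Rightarrow> 'a \<Rightarrow> bool" where
  "nas_object A a \<longleftrightarrow>
     non_anomalous_semigroup A \<and> a \<in> carrier A \<and> \<not> is_identity A a"

text \<open>Arrows are extensional (\<open>undefined\<close> off the carrier), so that equality of HOL functions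
  is equality of arrows.\<close>

definition nas_arrow :: "'a osemigroup \<Rightarrow> 'a \<Rightarrow> 'b osemigroup \<Rightarrow> 'b \<Rightarrow> ('a \<Rightarrow> 'b) \<Rightarrow> bool" where
  "nas_arrow A a B b f \<longleftrightarrow> f \<in> extensional (carrier A) \<and> morphism A B f \<and> f a = b"

text \<open>Objects range over all semigroups carried by subsets of the type \<open>'u\<close> in which
  \<open>R\<close> itself lives. Terminality among semigroups of all types implies this, so using it as a
  hypothesis does not lose generality.\<close>

definition nas_terminal :: "'u osemigroup \<Rightarrow> 'u \<Rightarrow> bool" where
  "nas_terminal R r \<longleftrightarrow> nas_object R r \<and>
     (\<forall>(A :: 'u osemigroup) a. nas_object A a \<longrightarrow> (\<exists>!f. nas_arrow A a R r f))"


section \<open>Archimedean groups, rings and fields\<close>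

definition archimedean_group :: "'a osemigroup \<Rightarrow> bool" where
  "archimedean_group G \<longleftrightarrow> totally_ordered_semigroup G \<and>
     (\<exists>z. group \<lparr>carrier = carrier G, monoid.mult = sadd G, one = z\<rparr> \<and>
       (\<forall>x\<in>carrier G. \<forall>y\<in>carrier G. z \<prec>\<^bsub>G\<^esub> x \<and> z \<prec>\<^bsub>G\<^esub> y \<longrightarrow>
          (\<exists>n\<ge>1. x \<prec>\<^bsub>G\<^esub> nsum G n y)) \<and>
       (\<forall>x\<in>carrier G. \<forall>y\<in>carrier G. x \<prec>\<^bsub>G\<^esub> z \<and> y \<prec>\<^bsub>G\<^esub> z \<longrightarrow>
          (\<exists>n\<ge>1. nsum G n y \<prec>\<^bsub>G\<^esub> x)))"

record 'a oring = "'a ring" +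
  rless :: "'a \<Rightarrow> 'a \<Rightarrow> bool"

definition additive_part :: "'a oring \<Rightarrow> 'a osemigroup" where
  "additive_part F = \<lparr>carrier = carrier F, sadd = add F, sless = rless F\<rparr>"

definition archimedean_ring :: "'a oring \<Rightarrow> bool" where
  "archimedean_ring F \<longleftrightarrow> ring F \<and> archimedean_group (additive_part F) \<and>
     \<one>\<^bsub>F\<^esub> \<noteq> \<zero>\<^bsub>F\<^esub> \<and>
     (\<forall>a\<in>carrier F. \<forall>b\<in>carrier F.
        rless F \<zero>\<^bsub>F\<^esub> a \<and> rless F \<zero>\<^bsub>F\<^esub> b \<longrightarrow> rless F \<zero>\<^bsub>F\<^esub> (a \<otimes>\<^bsub>F\<^esub> b))"

definition archimedean_field :: "'a oring \<Rightarrow> bool" where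
  "archimedean_field F \<longleftrightarrow>
     archimedean_ring F \<and> (\<forall>a\<in>carrier F. a \<noteq> \<zero>\<^bsub>F\<^esub> \<longrightarrow> a \<in> Units F)"

definition af_arrow :: "'a oring \<Rightarrow> 'b oring \<Rightarrow> ('a \<Rightarrow> 'b) \<Rightarrow> bool" where
  "af_arrow F K f \<longleftrightarrow> f \<in> extensional (carrier F) \<and> f \<in> ring_hom F K \<and>
     morphism (additive_part F) (additive_part K) f"

text \<open>Here the source objects may live in any type \<open>'v\<close>, not necessarily that of \<open>K\<close>;
  a theorem concluding this for a free type variable \<open>'v\<close> covers Archimedean fields of all
  types.\<close>

definition af_terminal :: "'v itself \<Rightarrow> 'u oring \<Rightarrow> bool" where
  "af_terminal _ K \<longleftrightarrow> archimedean_field K \<and>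
     (\<forall>F :: 'v oring. archimedean_field F \<longrightarrow> (\<exists>!f. af_arrow F K f))"


section \<open>Products with a chosen identity\<close>

definition neutral :: "'a osemigroup \<Rightarrow> 'a" where
  "neutral A = (THE z. is_identity A z)"

text \<open>The order is replaced by its dual when the chosen multiplicative identity \<open>e\<close> is
  not positive.\<close>

definition oriented :: "'a osemigroup \<Rightarrow> 'a \<Rightarrow> 'a osemigroup" where
  "oriented A e = (if neutral A \<prec>\<^bsub>A\<^esub> e then A else dual A)"

definition with_product :: "'a osemigroup \<Rightarrow> 'a \<Rightarrow> ('a \<Rightarrow> 'a \<Rightarrow> 'a) \<Rightarrow> 'a oring" where
  "with_product A e m =
     \<lparr>carrier = carrier A, monoid.mult = m, one = e, zero = neutral A, add = sadd A,
      rless = sless (oriented A e)\<rparr>"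

definition is_product :: "'a osemigroup \<Rightarrow> 'a \<Rightarrow> ('a \<Rightarrow> 'a \<Rightarrow> 'a) \<Rightarrow> bool" where
  "is_product A e m \<longleftrightarrow>
     m \<in> carrier A \<rightarrow>\<^sub>E (carrier A \<rightarrow>\<^sub>E carrier A) \<and> archimedean_ring (with_product A e m)"

end

theory Submission
  imports Defs "HOL-Library.Countable_Set" Complex_Main
begin

text \<open>
  The semigroup structure of the terminal object leaves no room for choice because every pointed
  non-anomalous semigroup has exactly one morphism to \<open>(\<real>, 1)\<close>, the classical real line.

  Existence (\<open>real_embedding_exists\<close>) is a Hoelder-type argument. A positive point \<open>a\<close> is used as a
  unit of length: the absence of anomalous pairs makes every element lie between two consecutive
  "integer multiples" of \<open>a\<close>, which gives an integer part that is additive up to an error of 1.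
  Homogenizing it along multiples \<open>nx\<close> yields an additive map to \<open>\<real>\<close>; it is strictly monotone,
  since two elements with the same value would form an anomalous pair, possibly after translating
  them by \<open>a\<close>. Commutativity is not
  assumed: \<open>n(x + y)\<close> always lies between \<open>nx + ny\<close> and \<open>ny + nx\<close> (\<open>nsum_add_between\<close>).
  Uniqueness (\<open>real_morphism_unique\<close>) holds because a morphism to \<open>\<real>\<close> is determined by comparing
  multiples of an element with multiples of the point.

  Two consequences carry the theorem. The embedding of the terminal object into \<open>\<real>\<close> is onto
  (\<open>terminal_object_surj\<close>): for each real \<open>t\<close> the group \<open>\<int> + \<int>t\<close> maps to the terminal object and
  from there to \<open>\<real>\<close>, by uniqueness via the inclusion. And the embedding of an Archimedean ring that
  takes 1 to 1 is multiplicative (\<open>real_morphism_multiplicative\<close>), since multiplication by a positive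
  element followed by normalization is another such embedding. So after scaling the embedding to
  take the chosen identity \<open>e\<close> to 1, the terminal object is a copy of \<open>\<real>\<close> on which any product with
  identity \<open>e\<close> must be the transported multiplication of reals, and Archimedean fields embed into it
  in exactly one way.
\<close>

section \<open>Order and multiples in a totally ordered semigroup\<close>

lemma nsum_dual [simp]: "nsum (dual A) n x = nsum A n x"
  by (simp add: nsum_def dual_def)

context totally_ordered_semigroup
begin

definition le :: "'a \<Rightarrow> 'a \<Rightarrow> bool" (infix "\<preceq>" 50) where
  "x \<preceq> y \<longleftrightarrow> x \<prec> y \<or> x = y"

lemma less_irrefl: "x \<in> carrier A \<Longrightarrow> \<not> x \<prec> x"
  using trichotomy by blast

lemma le_refl: "x \<preceq> x"
  by (simp add: le_def)

lemma less_imp_le: "x \<prec> y \<Longrightarrow> x \<preceq> y"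
  by (simp add: le_def)

lemma not_less_iff: "\<lbrakk>x \<in> carrier A; y \<in> carrier A\<rbrakk> \<Longrightarrow> \<not> x \<prec> y \<longleftrightarrow> y \<preceq> x"
  using trichotomy[of x y] by (auto simp: le_def)

lemma le_trans: "\<lbrakk>x \<preceq> y; y \<preceq> z; x \<in> carrier A; y \<in> carrier A; z \<in> carrier A\<rbrakk> \<Longrightarrow> x \<preceq> z"
  using less_trans[of x y z] by (auto simp: le_def)

lemma le_less_trans: "\<lbrakk>x \<preceq> y; y \<prec> z; x \<in> carrier A; y \<in> carrier A; z \<in> carrier A\<rbrakk> \<Longrightarrow> x \<prec> z"
  using less_trans[of x y z] by (auto simp: le_def)

lemma less_le_trans: "\<lbrakk>x \<prec> y; y \<preceq> z; x \<in> carrier A; y \<in> carrier A; z \<in> carrier A\<rbrakk> \<Longrightarrow> x \<prec> z"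
  using less_trans[of x y z] by (auto simp: le_def)

lemma add_le_right: "\<lbrakk>x \<preceq> y; x \<in> carrier A; y \<in> carrier A; z \<in> carrier A\<rbrakk> \<Longrightarrow> x \<boxplus> z \<preceq> y \<boxplus> z"
  using add_mono_right[of x y z] by (auto simp: le_def)

lemma add_le_left: "\<lbrakk>x \<preceq> y; x \<in> carrier A; y \<in> carrier A; z \<in> carrier A\<rbrakk> \<Longrightarrow> z \<boxplus> x \<preceq> z \<boxplus> y"
  using add_mono_left[of x y z] by (auto simp: le_def)

lemma add_le_mono:
  "\<lbrakk>x \<preceq> y; u \<preceq> v; x \<in> carrier A; y \<in> carrier A; u \<in> carrier A; v \<in> carrier A\<rbrakk>
    \<Longrightarrow> x \<boxplus> u \<preceq> y \<boxplus> v"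
  by (meson add_le_left add_le_right closed le_trans)

lemma add_less_cancel_right:
  "\<lbrakk>x \<in> carrier A; y \<in> carrier A; z \<in> carrier A\<rbrakk> \<Longrightarrow> x \<boxplus> z \<prec> y \<boxplus> z \<longleftrightarrow> x \<prec> y"
  using add_mono_right[of x y z] add_mono_right[of y x z] trichotomy[of x y]
    trichotomy[of "x \<boxplus> z" "y \<boxplus> z"] closed by auto

lemma add_less_cancel_left:
  "\<lbrakk>x \<in> carrier A; y \<in> carrier A; z \<in> carrier A\<rbrakk> \<Longrightarrow> z \<boxplus> x \<prec> z \<boxplus> y \<longleftrightarrow> x \<prec> y"
  using add_mono_left[of x y z] add_mono_left[of y x z] trichotomy[of x y]
    trichotomy[of "z \<boxplus> x" "z \<boxplus> y"] closed by auto

lemma add_cancel_right: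
  "\<lbrakk>x \<boxplus> z = y \<boxplus> z; x \<in> carrier A; y \<in> carrier A; z \<in> carrier A\<rbrakk> \<Longrightarrow> x = y"
  using add_less_cancel_right[of x y z] add_less_cancel_right[of y x z] trichotomy[of x y]
    less_irrefl closed by auto

lemma add_cancel_left:
  "\<lbrakk>z \<boxplus> x = z \<boxplus> y; x \<in> carrier A; y \<in> carrier A; z \<in> carrier A\<rbrakk> \<Longrightarrow> x = y"
  using add_less_cancel_left[of x y z] add_less_cancel_left[of y x z] trichotomy[of x y]
    less_irrefl closed by auto

lemma idempotent_imp_identity:
  assumes "a \<in> carrier A" "a \<boxplus> a = a"
  shows "is_identity A a"
  unfolding is_identity_def
proof (intro conjI ballI)
  fix x assume x: "x \<in> carrier A"
  show "a \<boxplus> x = x"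
    using add_cancel_left[of a "a \<boxplus> x" x] assoc[of a a x] assms x closed by simp
  show "x \<boxplus> a = x"
    using add_cancel_right[of "x \<boxplus> a" a x] assoc[of x a a] assms x closed by simp
qed (use assms in simp)

lemma nsum_1 [simp]: "nsum A (Suc 0) x = x"
  by (simp add: nsum_def)

lemma nsum_Suc: "1 \<le> n \<Longrightarrow> nsum A (Suc n) x = nsum A n x \<boxplus> x"
  by (cases n) (auto simp: nsum_def)

lemma nsum_closed: "x \<in> carrier A \<Longrightarrow> nsum A n x \<in> carrier A"
proof (induction n)
  case (Suc n)
  then show ?case
    by (cases "n = 0") (auto simp: nsum_Suc closed)
qed (simp add: nsum_def)

lemma nsum_add:
  assumes x: "x \<in> carrier A" and "1 \<le> m" "1 \<le> n"
  shows "nsum A (m + n) x = nsum A m x \<boxplus> nsum A n x"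
  using \<open>1 \<le> n\<close>
proof (induction n rule: dec_induct)
  case base
  then show ?case using \<open>1 \<le> m\<close> by (simp add: nsum_Suc)
next
  case (step n)
  then show ?case using x \<open>1 \<le> m\<close> by (simp add: nsum_Suc assoc nsum_closed)
qed

lemma nsum_Suc_left: "\<lbrakk>x \<in> carrier A; 1 \<le> n\<rbrakk> \<Longrightarrow> nsum A (Suc n) x = x \<boxplus> nsum A n x"
  using nsum_add[of x 1 n] by simp

lemma nsum_mono:
  assumes "x \<in> carrier A" "y \<in> carrier A" "x \<preceq> y" "1 \<le> n"
  shows "nsum A n x \<preceq> nsum A n y"
  using \<open>1 \<le> n\<close>
proof (induction n rule: dec_induct)
  case (step n)
  then show ?case using assms by (simp add: nsum_Suc add_le_mono nsum_closed)
qed (use assms in simp)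

text \<open>Moving one summand past many: every transposition goes in the direction of the hypothesis.\<close>

lemma nsum_commute_le:
  assumes x: "x \<in> carrier A" and y: "y \<in> carrier A" and le: "x \<boxplus> y \<preceq> y \<boxplus> x" and "1 \<le> n"
  shows "nsum A n x \<boxplus> y \<preceq> y \<boxplus> nsum A n x" "x \<boxplus> nsum A n y \<preceq> nsum A n y \<boxplus> x"
proof -
  note c = nsum_closed closed x y
  have "nsum A n x \<boxplus> y \<preceq> y \<boxplus> nsum A n x \<and> x \<boxplus> nsum A n y \<preceq> nsum A n y \<boxplus> x"
    using \<open>1 \<le> n\<close>
  proof (induction n rule: dec_induct)
    case (step n)
    let ?x = "nsum A n x" and ?y = "nsum A n y"
    have "?x \<boxplus> (x \<boxplus> y) \<preceq> ?x \<boxplus> (y \<boxplus> x)" "(?x \<boxplus> y) \<boxplus> x \<preceq> (y \<boxplus> ?x) \<boxplus> x"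
      using le step c by (simp_all add: add_le_left add_le_right)
    then have 1: "(?x \<boxplus> x) \<boxplus> y \<preceq> y \<boxplus> (?x \<boxplus> x)"
      using le_trans[of "?x \<boxplus> x \<boxplus> y" "?x \<boxplus> y \<boxplus> x" "y \<boxplus> ?x \<boxplus> x"] c by (simp add: assoc)
    have "?y \<boxplus> (x \<boxplus> y) \<preceq> ?y \<boxplus> (y \<boxplus> x)" "(x \<boxplus> ?y) \<boxplus> y \<preceq> (?y \<boxplus> x) \<boxplus> y"
      using le step c by (simp_all add: add_le_left add_le_right)
    then have "x \<boxplus> (?y \<boxplus> y) \<preceq> (?y \<boxplus> y) \<boxplus> x"
      using le_trans[of "x \<boxplus> ?y \<boxplus> y" "?y \<boxplus> x \<boxplus> y" "?y \<boxplus> y \<boxplus> x"] c by (simp add: assoc)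
    with 1 step show ?case by (simp add: nsum_Suc)
  qed (use le in simp)
  then show "nsum A n x \<boxplus> y \<preceq> y \<boxplus> nsum A n x" "x \<boxplus> nsum A n y \<preceq> nsum A n y \<boxplus> x" by auto
qed

lemma nsum_add_between_le:
  assumes x: "x \<in> carrier A" and y: "y \<in> carrier A" and le: "x \<boxplus> y \<preceq> y \<boxplus> x" and "1 \<le> n"
  shows "nsum A n x \<boxplus> nsum A n y \<preceq> nsum A n (x \<boxplus> y) \<and>
         nsum A n (x \<boxplus> y) \<preceq> nsum A n y \<boxplus> nsum A n x"
  using \<open>1 \<le> n\<close>
proof (induction n rule: dec_induct)
  case (step n)
  note c = nsum_closed closed x y
  let ?x = "nsum A n x" and ?y = "nsum A n y" and ?z = "nsum A n (x \<boxplus> y)"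
  have "?x \<boxplus> ((x \<boxplus> ?y) \<boxplus> y) \<preceq> ?x \<boxplus> ((?y \<boxplus> x) \<boxplus> y)"
    using nsum_commute_le[OF x y le step(1)] c by (simp add: add_le_left add_le_right)
  moreover have "(?x \<boxplus> ?y) \<boxplus> (x \<boxplus> y) \<preceq> ?z \<boxplus> (x \<boxplus> y)"
    using step c by (simp add: add_le_right)
  ultimately have 1: "(?x \<boxplus> x) \<boxplus> (?y \<boxplus> y) \<preceq> ?z \<boxplus> (x \<boxplus> y)"
    using le_trans[of "(?x \<boxplus> x) \<boxplus> (?y \<boxplus> y)" "(?x \<boxplus> ?y) \<boxplus> (x \<boxplus> y)" "?z \<boxplus> (x \<boxplus> y)"] c
    by (simp add: assoc)
  have "?z \<boxplus> (x \<boxplus> y) \<preceq> (?y \<boxplus> ?x) \<boxplus> (y \<boxplus> x)"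
    using step le c by (simp add: add_le_mono)
  moreover have "?y \<boxplus> ((?x \<boxplus> y) \<boxplus> x) \<preceq> ?y \<boxplus> ((y \<boxplus> ?x) \<boxplus> x)"
    using nsum_commute_le[OF x y le step(1)] c by (simp add: add_le_left add_le_right)
  ultimately have "?z \<boxplus> (x \<boxplus> y) \<preceq> (?y \<boxplus> y) \<boxplus> (?x \<boxplus> x)"
    using le_trans[of "?z \<boxplus> (x \<boxplus> y)" "(?y \<boxplus> ?x) \<boxplus> (y \<boxplus> x)" "(?y \<boxplus> y) \<boxplus> (?x \<boxplus> x)"] c
    by (simp add: assoc)
  with 1 step show ?case by (simp add: nsum_Suc)
qed (use le in \<open>simp add: le_refl\<close>)

lemma dual: "totally_ordered_semigroup (dual A)"
proof
  fix x y z assume "x \<in> carrier (dual A)" "y \<in> carrier (dual A)" "z \<in> carrier (dual A)"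
    "x \<prec>\<^bsub>dual A\<^esub> y" "y \<prec>\<^bsub>dual A\<^esub> z"
  then show "x \<prec>\<^bsub>dual A\<^esub> z"
    using less_trans[of z y x] by (simp add: dual_def)
next
  fix x y assume "x \<in> carrier (dual A)" "y \<in> carrier (dual A)"
  then show "(x \<prec>\<^bsub>dual A\<^esub> y \<and> x \<noteq> y \<and> \<not> y \<prec>\<^bsub>dual A\<^esub> x) \<or>
    (\<not> x \<prec>\<^bsub>dual A\<^esub> y \<and> x = y \<and> \<not> y \<prec>\<^bsub>dual A\<^esub> x) \<or>
    (\<not> x \<prec>\<^bsub>dual A\<^esub> y \<and> x \<noteq> y \<and> y \<prec>\<^bsub>dual A\<^esub> x)"
    using trichotomy[of x y] by (auto simp: dual_def)
qed (simp_all add: dual_def closed assoc add_mono_right add_mono_left)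

text \<open>The substitute for commutativity: whichever of \<open>x \<boxplus> y\<close> and \<open>y \<boxplus> x\<close> is the smaller one,
  sorting the summands of \<open>n(x \<boxplus> y)\<close> step by step in either direction changes the sum
  monotonically. The second case is the first one in the dual semigroup.\<close>

lemma nsum_add_between:
  assumes x: "x \<in> carrier A" and y: "y \<in> carrier A" and n: "1 \<le> n"
  obtains "nsum A n x \<boxplus> nsum A n y \<preceq> nsum A n (x \<boxplus> y)"
      "nsum A n (x \<boxplus> y) \<preceq> nsum A n y \<boxplus> nsum A n x"
    | "nsum A n y \<boxplus> nsum A n x \<preceq> nsum A n (x \<boxplus> y)"
      "nsum A n (x \<boxplus> y) \<preceq> nsum A n x \<boxplus> nsum A n y"
proof (cases "x \<boxplus> y \<preceq> y \<boxplus> x")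
  case True
  with nsum_add_between_le[OF x y _ n] that(1) show ?thesis by blast
next
  case False
  then have le: "y \<boxplus> x \<preceq> x \<boxplus> y"
    using not_less_iff less_imp_le closed x y by blast
  interpret D: totally_ordered_semigroup "dual A" by (rule dual)
  have D_le: "D.le u v \<longleftrightarrow> v \<preceq> u" for u v
    unfolding D.le_def le_def by (auto simp: dual_def)
  have "carrier (dual A) = carrier A" "sadd (dual A) = sadd A"
    by (simp_all add: dual_def)
  from D.nsum_add_between_le[unfolded this D_le nsum_dual, OF x y le n] that(2)
  show ?thesis by blast
qed

text \<open>Cancelling \<open>b\<close> in \<open>z \<boxplus> v \<boxplus> b \<prec> z \<boxplus> b\<close> gives the second claim for every element, and
  cancelling \<open>y\<close> on the left in \<open>y \<boxplus> v \<boxplus> y \<prec> y \<boxplus> y\<close> then gives the first.\<close>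

lemma absorb_less:
  assumes "v \<boxplus> b \<prec> b" and v: "v \<in> carrier A" and b: "b \<in> carrier A" and y: "y \<in> carrier A"
  shows "v \<boxplus> y \<prec> y" "y \<boxplus> v \<prec> y"
proof -
  have 1: "z \<boxplus> v \<prec> z" if z: "z \<in> carrier A" for z
  proof -
    have "z \<boxplus> (v \<boxplus> b) \<prec> z \<boxplus> b"
      using assms z closed add_mono_left by blast
    then show ?thesis
      using add_less_cancel_right[of "z \<boxplus> v" z b] assms z closed assoc by simp
  qed
  then show "y \<boxplus> v \<prec> y" using y .
  have "(y \<boxplus> v) \<boxplus> y \<prec> y \<boxplus> y"
    using 1 y v closed add_mono_right by blast
  then show "v \<boxplus> y \<prec> y"
    using add_less_cancel_left[of "v \<boxplus> y" y y] y v closed assoc by simp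
qed

end


section \<open>The integer part relative to a positive element\<close>

locale positively_pointed = totally_ordered_semigroup +
  fixes a
  assumes not_anomalous: "\<not> anomalous_pair A x y"
    and point_closed: "a \<in> carrier A"
    and point_positive: "a \<prec> a \<boxplus> a"
begin

abbreviation times_point :: "nat \<Rightarrow> 'a" where
  "times_point n \<equiv> nsum A n a"

lemma less_add_point: "x \<in> carrier A \<Longrightarrow> x \<prec> x \<boxplus> a"
  using add_mono_left[of a "a \<boxplus> a" x] add_less_cancel_right[of x "x \<boxplus> a" a]
    point_positive point_closed closed assoc by simp

lemma times_point_closed [simp]: "times_point n \<in> carrier A"
  by (rule nsum_closed[OF point_closed])

lemma times_point_add:
  "\<lbrakk>x \<in> carrier A; 1 \<le> m; 1 \<le> n\<rbrakk> \<Longrightarrow> x \<boxplus> times_point m \<boxplus> times_point n = x \<boxplus> times_point (m + n)"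
  by (simp add: nsum_add point_closed assoc)

lemma times_point_strict:
  assumes "1 \<le> m" "m < n"
  shows "times_point m \<prec> times_point n"
  using \<open>m < n\<close>
proof (induction n rule: less_induct)
  case (less n)
  then obtain n' where n': "n = Suc n'" by (cases n) auto
  with less.prems have "m \<le> n'" by simp
  with assms(1) have step: "times_point n' \<prec> times_point n"
    using n' by (simp add: nsum_Suc less_add_point)
  show ?case
  proof (cases "m = n'")
    case False
    then have "times_point m \<prec> times_point n'"
      using less.IH[of n'] n' \<open>m \<le> n'\<close> by simp
    with step show ?thesis
      using less_trans[of "times_point m" "times_point n'" "times_point n"] by simp
  qed (use step in simp)
qed

lemma times_point_less_iff:
  assumes "1 \<le> m" "1 \<le> n"
  shows "times_point m \<prec> times_point n \<longleftrightarrow> m < n"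
proof
  assume "times_point m \<prec> times_point n"
  then show "m < n"
    using times_point_strict[of n m] less_irrefl[of "times_point m"] assms
      trichotomy[of "times_point m" "times_point n"] by (cases m n rule: linorder_cases) auto
qed (use assms times_point_strict in blast)

text \<open>If \<open>x\<close> were above all multiples of \<open>a\<close>, then \<open>n(x \<boxplus> a)\<close>, being at most a sum of \<open>nx\<close> and
  \<open>na\<close>, would stay below \<open>(n + 1)x\<close>, and \<open>x\<close>, \<open>x \<boxplus> a\<close> would be anomalous.\<close>

lemma ex_greater_times_point:
  assumes x: "x \<in> carrier A"
  shows "\<exists>k\<ge>1. x \<prec> times_point k"
proof (rule ccontr)
  assume "\<not> ?thesis"
  then have le: "times_point k \<preceq> x" if "1 \<le> k" for k
    using that not_less_iff x times_point_closed by blast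
  have less: "times_point k \<prec> x" if "1 \<le> k" for k
    using less_le_trans[OF times_point_strict[of k "Suc k"] le[of "Suc k"]] that x by simp
  note c = closed nsum_closed x point_closed
  have "nsum A n (x \<boxplus> a) \<prec> nsum A (n + 1) x" if n: "1 \<le> n" for n
  proof -
    have 1: "times_point n \<boxplus> nsum A n x \<prec> nsum A (n + 1) x"
      using add_mono_right[OF _ _ _ less[OF n], of "nsum A n x"] c n by (simp add: nsum_Suc_left)
    have 2: "nsum A n x \<boxplus> times_point n \<prec> nsum A (n + 1) x"
      using add_mono_left[OF _ _ _ less[OF n], of "nsum A n x"] c n by (simp add: nsum_Suc)
    from nsum_add_between[OF x point_closed n] show ?thesis
      by cases (use 1 2 le_less_trans c in blast)+
  qed
  then have "anomalous_pair A (x \<boxplus> a) x"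
    using c less_add_point by (auto simp: anomalous_pair_def)
  with not_anomalous show False by blast
qed

text \<open>The counterpart for negative \<open>x\<close>: if no multiple of \<open>a\<close> compensated \<open>x\<close>, then all
  \<open>x \<boxplus> ma\<close> would be negative, and \<open>(n + 1)(x \<boxplus> a)\<close> would be below \<open>nx\<close> for every \<open>n\<close>.\<close>

lemma ex_add_times_point_ge:
  assumes x: "x \<in> carrier A"
  shows "\<exists>m\<ge>1. a \<preceq> x \<boxplus> times_point m"
proof (rule ccontr)
  note c = closed nsum_closed x point_closed
  assume "\<not> ?thesis"
  then have less: "x \<boxplus> times_point m \<prec> a" if "1 \<le> m" for m
    using that not_less_iff c by blast
  have right: "x \<boxplus> times_point m \<boxplus> a \<prec> a" if "1 \<le> m" for m
    using less[of "Suc m"] that c by (simp add: nsum_Suc assoc)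
  have left: "(times_point m \<boxplus> x) \<boxplus> times_point m \<prec> times_point m" if "1 \<le> m" for m
    using absorb_less(2)[OF right[OF that] _ _ times_point_closed[of m]] c by (simp add: assoc)
  have "nsum A (n + 1) (x \<boxplus> a) \<prec> nsum A n x" if n: "1 \<le> n" for n
  proof -
    have 1: "times_point (n + 1) \<boxplus> nsum A (n + 1) x \<prec> nsum A n x"
      using absorb_less(1)[OF left[of "n + 1"], of "nsum A n x"] c n
      by (simp add: nsum_Suc_left[of x] assoc)
    have 2: "nsum A (n + 1) x \<boxplus> times_point (n + 1) \<prec> nsum A n x"
      using absorb_less(2)[OF right[of "n + 1"], of "nsum A n x"] c n
      by (simp add: nsum_Suc[of _ x] assoc)
    from nsum_add_between[OF x point_closed, of "n + 1"] show ?thesis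
      by cases (use 1 2 le_less_trans c in auto)
  qed
  then have "anomalous_pair A (x \<boxplus> a) x"
    using c less_add_point by (auto simp: anomalous_pair_def)
  with not_anomalous show False by blast
qed

text \<open>Intuitively \<open>N \<le> x / a < N + 1\<close>. Adding \<open>ma\<close> on the right makes both sides of the comparison
  meaningful for negative \<open>x\<close> in a semigroup without inverses.\<close>

definition int_part_of :: "'a \<Rightarrow> int \<Rightarrow> bool" where
  "int_part_of x N \<longleftrightarrow> (\<exists>k m. 1 \<le> k \<and> 1 \<le> m \<and> N = int k - int m \<and>
     times_point k \<preceq> x \<boxplus> times_point m \<and> x \<boxplus> times_point m \<prec> times_point (k + 1))"

lemma int_part_exists:
  assumes x: "x \<in> carrier A"
  shows "\<exists>N. int_part_of x N"
proof -
  from ex_add_times_point_ge[OF x] obtain m where m: "1 \<le> m" "a \<preceq> x \<boxplus> times_point m" by blast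
  let ?z = "x \<boxplus> times_point m"
  have z: "?z \<in> carrier A" using x closed by simp
  define P where "P k \<longleftrightarrow> 1 \<le> k \<and> ?z \<prec> times_point k" for k
  define K where "K = (LEAST k. P k)"
  have "\<exists>k. P k"
    using ex_greater_times_point[OF z] by (auto simp: P_def)
  then have K: "P K"
    unfolding K_def by (rule LeastI_ex)
  have "K \<noteq> 1" using K m(2) not_less_iff[OF z point_closed] by (auto simp: P_def)
  with K obtain k where k: "K = k + 1" "1 \<le> k"
    by (cases K) (auto simp: P_def)
  have "\<not> P k" using k(1) not_less_Least[of k P] by (simp add: K_def)
  then have "times_point k \<preceq> ?z" using k(2) z by (simp add: P_def not_less_iff)
  then have "int_part_of x (int k - int m)"
    unfolding int_part_of_def using K k m(1) by (auto simp: P_def)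
  then show ?thesis ..
qed

lemma int_part_of_mono:
  assumes x: "x \<in> carrier A" and y: "y \<in> carrier A" and le: "x \<preceq> y"
    and "int_part_of x M" "int_part_of y N"
  shows "M \<le> N"
proof -
  from assms(4) obtain k m where k: "1 \<le> k" "1 \<le> m" "M = int k - int m"
    "times_point k \<preceq> x \<boxplus> times_point m" unfolding int_part_of_def by blast
  from assms(5) obtain k' m' where k': "1 \<le> k'" "1 \<le> m'" "N = int k' - int m'"
    "y \<boxplus> times_point m' \<prec> times_point (k' + 1)" unfolding int_part_of_def by blast
  have "times_point k \<boxplus> times_point m' \<preceq> x \<boxplus> times_point m \<boxplus> times_point m'"
    using k(4) add_le_right x closed by simp
  then have 1: "times_point (k + m') \<preceq> x \<boxplus> times_point (m + m')"
    using k k' x by (simp add: nsum_add point_closed times_point_add)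
  have 2: "x \<boxplus> times_point (m + m') \<preceq> y \<boxplus> times_point (m + m')"
    using le x y by (simp add: add_le_right)
  have "y \<boxplus> times_point m' \<boxplus> times_point m \<prec> times_point (k' + 1) \<boxplus> times_point m"
    using k'(4) add_mono_right y closed by simp
  then have 3: "y \<boxplus> times_point (m + m') \<prec> times_point (k' + 1 + m)"
    using nsum_add[of a "k' + 1" m] k k' y
    by (simp add: point_closed times_point_add add.commute[of m'])
  have "times_point (k + m') \<prec> times_point (k' + 1 + m)"
    using le_less_trans[OF le_trans[OF 1 2] 3] x y closed by simp
  then show ?thesis
    using times_point_less_iff[of "k + m'" "k' + 1 + m"] k k' by simp
qed

lemma int_part_of_add:
  assumes x: "x \<in> carrier A" and y: "y \<in> carrier A"
    and "int_part_of x M" "int_part_of y N"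
  shows "int_part_of (x \<boxplus> y) (M + N) \<or> int_part_of (x \<boxplus> y) (M + N + 1)"
proof -
  from assms(3) obtain k m where k: "1 \<le> k" "1 \<le> m" "M = int k - int m"
    "times_point k \<preceq> x \<boxplus> times_point m" "x \<boxplus> times_point m \<prec> times_point (k + 1)"
    unfolding int_part_of_def by blast
  from assms(4) obtain k' m' where k': "1 \<le> k'" "1 \<le> m'" "N = int k' - int m'"
    "times_point k' \<preceq> y \<boxplus> times_point m'" "y \<boxplus> times_point m' \<prec> times_point (k' + 1)"
    unfolding int_part_of_def by blast
  let ?z = "x \<boxplus> y \<boxplus> times_point (m + m')"
  note c = closed x y times_point_closed
  \<comment> \<open>multiples of the point commute with each other, which lets \<open>m\<close> pass by the bounds for \<open>y\<close>\<close>
  have shift: "x \<boxplus> times_point j \<boxplus> times_point m = x \<boxplus> times_point m \<boxplus> times_point j"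
    if "1 \<le> j" for j
    using that k x by (simp add: times_point_add add.commute)
  have z: "?z = x \<boxplus> (y \<boxplus> times_point m') \<boxplus> times_point m"
    using times_point_add[of "x \<boxplus> y" m' m] k k' c by (simp add: assoc add.commute)
  have 1: "times_point (k + k') \<preceq> ?z"
  proof -
    have "times_point k \<boxplus> times_point k' \<preceq> x \<boxplus> times_point m \<boxplus> times_point k'"
      using k c by (simp add: add_le_right)
    moreover have "x \<boxplus> times_point k' \<boxplus> times_point m \<preceq> ?z"
      unfolding z using k' c by (simp add: add_le_left add_le_right)
    ultimately show ?thesis
      using le_trans[of "times_point k \<boxplus> times_point k'" "x \<boxplus> times_point m \<boxplus> times_point k'" ?z]
        shift k k' c by (simp add: nsum_add point_closed)
  qed
  have 2: "?z \<prec> times_point (k + k' + 2)"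
  proof -
    have "x \<boxplus> times_point m \<boxplus> times_point (k' + 1) \<prec> times_point (k + 1) \<boxplus> times_point (k' + 1)"
      using k(5) c by (intro add_mono_right) auto
    moreover have "?z \<prec> x \<boxplus> times_point (k' + 1) \<boxplus> times_point m"
      unfolding z using k'(5) c by (intro add_mono_right add_mono_left) auto
    ultimately show ?thesis
      using less_trans[of ?z "x \<boxplus> times_point m \<boxplus> times_point (k' + 1)"
          "times_point (k + 1) \<boxplus> times_point (k' + 1)"]
        shift[of "k' + 1"] nsum_add[of a "k + 1" "k' + 1"] k k' c by (simp add: point_closed)
  qed
  have zc: "?z \<in> carrier A" using c by simp
  show ?thesis
  proof (cases "?z \<prec> times_point (k + k' + 1)")
    case True
    then have "int_part_of (x \<boxplus> y) (M + N)"
      unfolding int_part_of_def using 1 k k' by (intro exI[of _ "k + k'"] exI[of _ "m + m'"]) auto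
    then show ?thesis ..
  next
    case False
    then have "times_point (k + k' + 1) \<preceq> ?z"
      using not_less_iff[OF zc, of "times_point (k + k' + 1)"] by simp
    then have "int_part_of (x \<boxplus> y) (M + N + 1)"
      unfolding int_part_of_def using 2 k k'
      by (intro exI[of _ "k + k' + 1"] exI[of _ "m + m'"]) (auto simp: numeral_2_eq_2)
    then show ?thesis ..
  qed
qed

definition int_part :: "'a \<Rightarrow> int" where
  "int_part x = (SOME N. int_part_of x N)"

lemma int_part: "x \<in> carrier A \<Longrightarrow> int_part_of x (int_part x)"
  unfolding int_part_def using int_part_exists by (rule someI_ex)

lemma int_part_unique: "\<lbrakk>x \<in> carrier A; int_part_of x N\<rbrakk> \<Longrightarrow> int_part x = N"
  using int_part_of_mono[of x x "int_part x" N] int_part_of_mono[of x x N "int_part x"]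
    int_part[of x] by (simp add: le_refl)

lemma int_part_mono: "\<lbrakk>x \<in> carrier A; y \<in> carrier A; x \<preceq> y\<rbrakk> \<Longrightarrow> int_part x \<le> int_part y"
  using int_part_of_mono int_part by blast

lemma int_part_add:
  assumes "x \<in> carrier A" "y \<in> carrier A"
  shows "int_part x + int_part y \<le> int_part (x \<boxplus> y)"
    "int_part (x \<boxplus> y) \<le> int_part x + int_part y + 1"
  using int_part_of_add[OF assms int_part[OF assms(1)] int_part[OF assms(2)]]
    int_part_unique[of "x \<boxplus> y"] assms closed by auto

lemma int_part_times_point:
  assumes "1 \<le> n"
  shows "int_part (times_point n) = int n"
proof (rule int_part_unique)
  have "times_point n \<boxplus> times_point 1 = times_point (n + 1)"
    using assms nsum_add[of a n 1] point_closed by simp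
  then show "int_part_of (times_point n) (int n)"
    unfolding int_part_of_def using times_point_strict[of "n + 1" "n + 1 + 1"]
    by (intro exI[of _ "n + 1"] exI[of _ 1]) (auto simp: le_refl)
qed simp

end


section \<open>Homogenization\<close>

text \<open>A sequence that is additive up to an error in \<open>{0, 1}\<close> stays within distance 1 of a linear one:
  comparing \<open>h (m * n)\<close> with \<open>m * h n\<close> and with \<open>n * h m\<close> gives \<open>h n / n \<le> (h m + 1) / m\<close>
  for all \<open>m\<close> and \<open>n\<close>, and any separating number is a slope.\<close>

lemma near_additive_slope:
  fixes h :: "nat \<Rightarrow> int"
  assumes h: "\<And>m n. \<lbrakk>1 \<le> m; 1 \<le> n\<rbrakk> \<Longrightarrow> h m + h n \<le> h (m + n) \<and> h (m + n) \<le> h m + h n + 1"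
  shows "\<exists>c::real. \<forall>n\<ge>1. \<bar>real n * c - h n\<bar> \<le> 1"
proof -
  have mult: "int m * h n \<le> h (m * n) \<and> h (m * n) \<le> int m * h n + int m"
    if "1 \<le> m" "1 \<le> n" for m n
    using \<open>1 \<le> m\<close>
  proof (induction m rule: dec_induct)
    case (step m)
    then show ?case using h[of n "m * n"] \<open>1 \<le> n\<close> by (auto simp: algebra_simps)
  qed auto
  define S where "S = (\<lambda>n. h n / real n) ` {1..}"
  have bound: "s \<le> (h m + 1) / real m" if "s \<in> S" "1 \<le> m" for s m
  proof -
    from \<open>s \<in> S\<close> obtain n where n: "1 \<le> n" "s = h n / real n" by (auto simp: S_def)
    have "int m * h n \<le> int n * h m + int n"
      using mult[of m n] mult[of n m] n \<open>1 \<le> m\<close> by (simp add: mult.commute)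
    then have "real_of_int (int m * h n) \<le> real_of_int (int n * h m + int n)"
      by (simp only: of_int_le_iff)
    then have "h n * real m \<le> (h m + 1) * real n" by (simp add: algebra_simps)
    then show ?thesis
      unfolding n(2) using n(1) \<open>1 \<le> m\<close> by (simp add: pos_divide_le_eq pos_le_divide_eq)
  qed
  have "S \<noteq> {}" by (auto simp: S_def)
  have "bdd_above S" using bound[where m = 1] by (intro bdd_aboveI) auto
  have "\<bar>real n * Sup S - h n\<bar> \<le> 1" if "1 \<le> n" for n
  proof -
    have "h n / real n \<le> Sup S"
      using that \<open>bdd_above S\<close> by (intro cSup_upper) (auto simp: S_def)
    moreover have "Sup S \<le> (h n + 1) / real n"
      using that bound \<open>S \<noteq> {}\<close> by (intro cSup_least) auto
    ultimately show ?thesis using that by (simp add: field_simps)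
  qed
  then show ?thesis by blast
qed

lemma nonpos_if_multiples_bounded:
  fixes d C :: real
  assumes "\<And>n. 1 \<le> n \<Longrightarrow> real n * d \<le> C"
  shows "d \<le> 0"
proof (rule ccontr)
  assume "\<not> d \<le> 0"
  then obtain n where n: "max C 0 < real n * d" using ex_less_of_nat_mult[of d "max C 0"] by auto
  then have "1 \<le> n" by (cases n) auto
  with assms[of n] n show False by simp
qed

context positively_pointed
begin

definition slope :: "'a \<Rightarrow> real" where
  "slope x = (SOME c. \<forall>n\<ge>1. \<bar>real n * c - int_part (nsum A n x)\<bar> \<le> 1)"

lemma slope:
  assumes x: "x \<in> carrier A" and n: "1 \<le> n"
  shows "\<bar>real n * slope x - int_part (nsum A n x)\<bar> \<le> 1"
proof -
  have "\<exists>c::real. \<forall>n\<ge>1. \<bar>real n * c - int_part (nsum A n x)\<bar> \<le> 1"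
    by (rule near_additive_slope) (simp add: nsum_add x nsum_closed int_part_add)
  from someI_ex[OF this] n show ?thesis unfolding slope_def by blast
qed

lemma slope_mono:
  assumes "x \<in> carrier A" "y \<in> carrier A" "x \<preceq> y"
  shows "slope x \<le> slope y"
proof -
  have "slope x - slope y \<le> 0"
  proof (rule nonpos_if_multiples_bounded)
    fix n :: nat assume n: "1 \<le> n"
    have "int_part (nsum A n x) \<le> int_part (nsum A n y)"
      using assms n by (intro int_part_mono nsum_mono nsum_closed)
    with slope[OF assms(1) n] slope[OF assms(2) n]
    show "real n * (slope x - slope y) \<le> 2" unfolding right_diff_distrib by linarith
  qed
  then show ?thesis by simp
qed

text \<open>Commutativity of the semigroup is a consequence, not an ingredient, of this lemma: \<open>n(x \<boxplus> y)\<close>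
  lies between the two sums of \<open>nx\<close> and \<open>ny\<close>, and their integer parts differ by at most 1.\<close>

lemma slope_add:
  assumes x: "x \<in> carrier A" and y: "y \<in> carrier A"
  shows "slope (x \<boxplus> y) = slope x + slope y"
proof -
  have bound: "\<bar>real n * (slope (x \<boxplus> y) - (slope x + slope y))\<bar> \<le> 4" if n: "1 \<le> n" for n
  proof -
    let ?X = "nsum A n x" and ?Y = "nsum A n y" and ?Z = "nsum A n (x \<boxplus> y)"
    have c: "?X \<in> carrier A" "?Y \<in> carrier A" "?Z \<in> carrier A" "x \<boxplus> y \<in> carrier A"
      using x y by (auto intro: nsum_closed closed)
    from nsum_add_between[OF x y n]
    have "int_part ?X + int_part ?Y \<le> int_part ?Z \<and> int_part ?Z \<le> int_part ?X + int_part ?Y + 1"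
    proof cases
      case 1
      then have "int_part (?X \<boxplus> ?Y) \<le> int_part ?Z" "int_part ?Z \<le> int_part (?Y \<boxplus> ?X)"
        using c closed by (auto intro: int_part_mono)
      with int_part_add[OF c(1,2)] int_part_add[OF c(2,1)] show ?thesis by linarith
    next
      case 2
      then have "int_part (?Y \<boxplus> ?X) \<le> int_part ?Z" "int_part ?Z \<le> int_part (?X \<boxplus> ?Y)"
        using c closed by (auto intro: int_part_mono)
      with int_part_add[OF c(1,2)] int_part_add[OF c(2,1)] show ?thesis by linarith
    qed
    with slope[OF x n] slope[OF y n] slope[OF c(4) n] show ?thesis
      unfolding right_diff_distrib distrib_left by linarith
  qed
  have "slope (x \<boxplus> y) - (slope x + slope y) \<le> 0"
    using bound by (intro nonpos_if_multiples_bounded[of _ 4]) (meson abs_le_D1)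
  moreover have "- (slope (x \<boxplus> y) - (slope x + slope y)) \<le> 0"
    using bound by (intro nonpos_if_multiples_bounded[of _ 4]) (metis abs_le_D2 mult_minus_right)
  ultimately show ?thesis by linarith
qed

lemma slope_point: "slope a = 1"
proof -
  have bound: "\<bar>real n * (slope a - 1)\<bar> \<le> 1" if n: "1 \<le> n" for n
    using slope[OF point_closed n] int_part_times_point[OF n] by (simp add: right_diff_distrib)
  have "slope a - 1 \<le> 0"
    using bound by (intro nonpos_if_multiples_bounded[of _ 1]) (meson abs_le_D1)
  moreover have "- (slope a - 1) \<le> 0"
    using bound by (intro nonpos_if_multiples_bounded[of _ 1]) (metis abs_le_D2 mult_minus_right)
  ultimately show ?thesis by linarith
qed

lemma slope_nsum:
  assumes "x \<in> carrier A" "1 \<le> n"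
  shows "slope (nsum A n x) = real n * slope x"
  using assms(2)
proof (induction n rule: dec_induct)
  case (step n)
  then show ?case using assms(1) by (simp add: nsum_Suc slope_add nsum_closed algebra_simps)
qed simp

text \<open>Distinct elements with the same nonzero slope \<open>c\<close> form an anomalous pair, as \<open>nc\<close> and
  \<open>(n + 1)c\<close> are then ordered in the same way for all \<open>n\<close>. Translating both elements by the point
  turns slope 0 into slope 1.\<close>

lemma slope_strict:
  assumes x: "x \<in> carrier A" and y: "y \<in> carrier A" and less: "x \<prec> y"
  shows "slope x < slope y"
proof -
  have zero: "slope u = 0"
    if u: "u \<in> carrier A" and v: "v \<in> carrier A" and "u \<prec> v" and eq: "slope u = slope v" for u v
  proof -
    from not_anomalous[of v u] u v \<open>u \<prec> v\<close> obtain m n where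
      m: "1 \<le> m" "\<not> nsum A m v \<prec> nsum A (m + 1) u" and
      n: "1 \<le> n" "\<not> nsum A (n + 1) v \<prec> nsum A n u"
      unfolding anomalous_pair_def by blast
    have "slope (nsum A (m + 1) u) \<le> slope (nsum A m v)"
      "slope (nsum A n u) \<le> slope (nsum A (n + 1) v)"
      using m n u v by (auto intro!: slope_mono nsum_closed simp del: Suc_eq_plus1 add_Suc_right
          simp: not_less_iff nsum_closed)
    with m(1) n(1) u v eq show ?thesis
      by (simp add: slope_nsum algebra_simps)
  qed
  have "slope x \<noteq> slope y"
  proof
    assume eq: "slope x = slope y"
    then have "slope x = 0" using zero x y less by blast
    moreover have "slope (a \<boxplus> x) = 0"
      using eq x y less point_closed
      by (intro zero[of _ "a \<boxplus> y"]) (auto intro: closed add_mono_left simp: slope_add)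
    ultimately show False using x by (simp add: slope_add point_closed slope_point)
  qed
  with slope_mono[OF x y] less show ?thesis by (simp add: le_def)
qed

end

section \<open>The real line as a terminal object\<close>

definition real_line :: "real osemigroup" where
  "real_line = \<lparr>carrier = UNIV, sadd = (+), sless = (<)\<rparr>"

lemma morphism_real_line_iff:
  "morphism A real_line f \<longleftrightarrow>
    (\<forall>x\<in>carrier A. \<forall>y\<in>carrier A. f (x \<boxplus>\<^bsub>A\<^esub> y) = f x + f y) \<and>
    ((\<forall>x\<in>carrier A. \<forall>y\<in>carrier A. x \<prec>\<^bsub>A\<^esub> y \<longrightarrow> f x < f y) \<or>
     (\<forall>x\<in>carrier A. \<forall>y\<in>carrier A. x \<prec>\<^bsub>A\<^esub> y \<longrightarrow> f y < f x))"
  by (auto simp: morphism_def positive_morphism_def negative_morphism_def additive_map_def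
      real_line_def)

lemma morphism_real_line_add:
  "\<lbrakk>morphism A real_line f; x \<in> carrier A; y \<in> carrier A\<rbrakk> \<Longrightarrow> f (x \<boxplus>\<^bsub>A\<^esub> y) = f x + f y"
  by (simp add: morphism_real_line_iff)

lemma morphism_real_line_dual: "morphism (dual A) real_line f \<longleftrightarrow> morphism A real_line f"
  by (auto simp: morphism_real_line_iff dual_def)

lemma non_anomalous_dual:
  "non_anomalous_semigroup A \<Longrightarrow> non_anomalous_semigroup (dual A)"
proof -
  assume A: "non_anomalous_semigroup A"
  have "anomalous_pair (dual A) x y \<Longrightarrow> anomalous_pair A y x" for x y
    unfolding anomalous_pair_def nsum_dual by (auto simp: dual_def)
  with A show ?thesis
    unfolding non_anomalous_semigroup_def using totally_ordered_semigroup.dual by blast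
qed

theorem real_embedding_exists:
  assumes "nas_object A a"
  shows "\<exists>f. morphism A real_line f \<and> f a = 1"
proof -
  have positive: "\<exists>f. morphism B real_line f \<and> f a = 1"
    if "non_anomalous_semigroup B" "a \<in> carrier B" "a \<prec>\<^bsub>B\<^esub> a \<boxplus>\<^bsub>B\<^esub> a" for B
  proof -
    interpret positively_pointed B a
      using that by (auto simp: positively_pointed_def positively_pointed_axioms_def
          non_anomalous_semigroup_def)
    show ?thesis
      using slope_add slope_strict slope_point
      by (intro exI[of _ slope]) (simp add: morphism_real_line_iff)
  qed
  from assms have A: "non_anomalous_semigroup A" "a \<in> carrier A" "\<not> is_identity A a"
    by (auto simp: nas_object_def)
  then interpret totally_ordered_semigroup A
    by (simp add: non_anomalous_semigroup_def)
  have "a \<boxplus>\<^bsub>A\<^esub> a \<noteq> a"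
    using idempotent_imp_identity A by blast
  then consider "a \<prec>\<^bsub>A\<^esub> a \<boxplus>\<^bsub>A\<^esub> a" | "a \<boxplus>\<^bsub>A\<^esub> a \<prec>\<^bsub>A\<^esub> a"
    using trichotomy[of a "a \<boxplus>\<^bsub>A\<^esub> a"] closed A by auto
  then show ?thesis
  proof cases
    case 2
    then have "\<exists>f. morphism (dual A) real_line f \<and> f a = 1"
      using A by (intro positive non_anomalous_dual) (auto simp: dual_def)
    then show ?thesis by (simp add: morphism_real_line_dual)
  qed (use A positive in blast)
qed

context totally_ordered_semigroup
begin

lemma additive_nsum:
  fixes f :: "'a \<Rightarrow> real"
  assumes add: "\<And>x y. \<lbrakk>x \<in> carrier A; y \<in> carrier A\<rbrakk> \<Longrightarrow> f (x \<boxplus> y) = f x + f y"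
    and x: "x \<in> carrier A" and n: "1 \<le> n"
  shows "f (nsum A n x) = real n * f x"
  using n
proof (induction n rule: dec_induct)
  case (step n)
  then show ?case using x by (simp add: nsum_Suc add nsum_closed algebra_simps)
qed simp

lemma positive_real_morphism_le:
  fixes f g :: "'a \<Rightarrow> real"
  assumes f: "\<And>x y. \<lbrakk>x \<in> carrier A; y \<in> carrier A\<rbrakk> \<Longrightarrow> f (x \<boxplus> y) = f x + f y"
      "\<And>x y. \<lbrakk>x \<in> carrier A; y \<in> carrier A; x \<prec> y\<rbrakk> \<Longrightarrow> f x < f y"
    and g: "\<And>x y. \<lbrakk>x \<in> carrier A; y \<in> carrier A\<rbrakk> \<Longrightarrow> g (x \<boxplus> y) = g x + g y"
      "\<And>x y. \<lbrakk>x \<in> carrier A; y \<in> carrier A; x \<prec> y\<rbrakk> \<Longrightarrow> g x < g y"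
    and a: "a \<in> carrier A" "f a = 1" "g a = 1" and x: "x \<in> carrier A"
  shows "f x \<le> g x"
proof (rule ccontr)
  assume "\<not> f x \<le> g x"
  then have "0 < f x - g x" by simp
  then obtain n where n: "1 < real n * (f x - g x)" using ex_less_of_nat_mult by blast
  then have n1: "1 \<le> n" by (cases n) auto
  \<comment> \<open>an integer strictly between \<open>n * g x\<close> and \<open>n * f x\<close>, written as a difference of positive
    naturals because the semigroup has no subtraction\<close>
  define N where "N = \<lceil>real n * f x\<rceil> - 1"
  define m where "m = nat (1 + \<bar>N\<bar>)"
  define k where "k = nat (N + int m)"
  have N: "real n * g x < N" "N < real n * f x"
    using n unfolding N_def right_diff_distrib by linarith+
  have m: "1 \<le> m" and k: "1 \<le> k" "int k = N + int m"
    unfolding k_def m_def by linarith+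
  then have rk: "real k = N + real m" by (metis of_int_add of_int_of_nat_eq)
  let ?l = "nsum A n x \<boxplus> nsum A m a" and ?r = "nsum A k a"
  have c: "?l \<in> carrier A" "?r \<in> carrier A" using x a nsum_closed closed by auto
  have fl: "f ?l = real n * f x + real m" "f ?r = real k"
    using f(1) additive_nsum[OF f(1)] n1 m k a x nsum_closed by auto
  have gl: "g ?l = real n * g x + real m" "g ?r = real k"
    using g(1) additive_nsum[OF g(1)] n1 m k a x nsum_closed by auto
  have "\<not> ?r \<prec> ?l" using g(2)[OF c(2,1)] gl N rk by linarith
  moreover have "?l \<noteq> ?r" using fl N rk by auto
  moreover have "\<not> ?l \<prec> ?r" using f(2)[OF c] fl N rk by linarith
  ultimately show False using trichotomy[OF c] by blast
qed

text \<open>Both morphisms give the point the value 1, so both are positive or both are negative; and a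
  morphism to the reals is then determined by the comparisons between the elements
  \<open>nx \<boxplus> ma\<close> and \<open>ka\<close>.\<close>

theorem real_morphism_unique:
  assumes f: "morphism A real_line f" and g: "morphism A real_line g"
    and a: "a \<in> carrier A" "f a = 1" "g a = 1" and x: "x \<in> carrier A"
  shows "f x = g x"
proof -
  let ?up = "\<lambda>h::'a \<Rightarrow> real. \<forall>x\<in>carrier A. \<forall>y\<in>carrier A. x \<prec> y \<longrightarrow> h x < h y"
  let ?down = "\<lambda>h::'a \<Rightarrow> real. \<forall>x\<in>carrier A. \<forall>y\<in>carrier A. x \<prec> y \<longrightarrow> h y < h x"
  have add: "f (x \<boxplus> y) = f x + f y" "g (x \<boxplus> y) = g x + g y"
    if "x \<in> carrier A" "y \<in> carrier A" for x y
    using f g that by (auto simp: morphism_real_line_iff)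
  have "f (a \<boxplus> a) = 2" "g (a \<boxplus> a) = 2" "a \<boxplus> a \<in> carrier A"
    using add a closed by auto
  then have mixed: "\<not> (?up f \<and> ?down g)" "\<not> (?up g \<and> ?down f)"
    using trichotomy[of a "a \<boxplus> a"] a by fastforce+
  with f g consider "?up f" "?up g" | "?down f" "?down g"
    unfolding morphism_real_line_iff by blast
  then show ?thesis
  proof cases
    case 1
    have "f x \<le> g x"
      by (rule positive_real_morphism_le[of f g a]) (use 1 add a x in auto)
    moreover have "g x \<le> f x"
      by (rule positive_real_morphism_le[of g f a]) (use 1 add a x in auto)
    ultimately show ?thesis by simp
  next
    case 2
    interpret D: totally_ordered_semigroup "dual A" by (rule dual)
    have d: "carrier (dual A) = carrier A" "sadd (dual A) = sadd A"
      "x \<prec>\<^bsub>dual A\<^esub> y \<longleftrightarrow> y \<prec> x" for x y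
      by (simp_all add: dual_def)
    have "f x \<le> g x"
      by (rule D.positive_real_morphism_le[unfolded d, of f g a]) (use 2 add a x in auto)
    moreover have "g x \<le> f x"
      by (rule D.positive_real_morphism_le[unfolded d, of g f a]) (use 2 add a x in auto)
    ultimately show ?thesis by simp
  qed
qed

lemma real_morphism_inj:
  assumes "morphism A real_line f"
  shows "inj_on f (carrier A)"
proof (rule inj_onI)
  fix x y assume "x \<in> carrier A" "y \<in> carrier A" "f x = f y"
  then show "x = y"
    using assms trichotomy[of x y] by (fastforce simp: morphism_real_line_iff)
qed

end

lemma non_anomalous_if_embeds_in_reals:
  fixes A :: "'a osemigroup" and f :: "'a \<Rightarrow> real"
  assumes closed: "\<And>x y. \<lbrakk>x \<in> carrier A; y \<in> carrier A\<rbrakk> \<Longrightarrow> x \<boxplus>\<^bsub>A\<^esub> y \<in> carrier A"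
    and add: "\<And>x y. \<lbrakk>x \<in> carrier A; y \<in> carrier A\<rbrakk> \<Longrightarrow> f (x \<boxplus>\<^bsub>A\<^esub> y) = f x + f y"
    and less: "\<And>x y. \<lbrakk>x \<in> carrier A; y \<in> carrier A\<rbrakk> \<Longrightarrow> x \<prec>\<^bsub>A\<^esub> y \<longleftrightarrow> f x < f y"
    and inj: "inj_on f (carrier A)"
  shows "non_anomalous_semigroup A"
proof -
  have eq: "x = y \<longleftrightarrow> f x = f y" if "x \<in> carrier A" "y \<in> carrier A" for x y
    using inj that by (auto dest: inj_onD)
  interpret totally_ordered_semigroup A
  proof
    fix x y assume xy: "x \<in> carrier A" "y \<in> carrier A"
    show "(x \<prec>\<^bsub>A\<^esub> y \<and> x \<noteq> y \<and> \<not> y \<prec>\<^bsub>A\<^esub> x) \<or> (\<not> x \<prec>\<^bsub>A\<^esub> y \<and> x = y \<and> \<not> y \<prec>\<^bsub>A\<^esub> x) \<or>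
      (\<not> x \<prec>\<^bsub>A\<^esub> y \<and> x \<noteq> y \<and> y \<prec>\<^bsub>A\<^esub> x)"
      unfolding less[OF xy] less[OF xy(2,1)] eq[OF xy] by linarith
  next
    fix x y z assume xyz: "x \<in> carrier A" "y \<in> carrier A" "z \<in> carrier A"
    show "x \<boxplus>\<^bsub>A\<^esub> y \<boxplus>\<^bsub>A\<^esub> z = x \<boxplus>\<^bsub>A\<^esub> (y \<boxplus>\<^bsub>A\<^esub> z)"
      using xyz by (subst eq) (simp_all add: closed add)
  qed (simp_all add: closed add less)
  have nsum: "f (nsum A n x) = real n * f x" if "x \<in> carrier A" "1 \<le> n" for n x
    using additive_nsum[OF add] that by blast
  have "\<not> anomalous_pair A x y" for x y
  proof
    assume "anomalous_pair A x y"
    then have x: "x \<in> carrier A" and y: "y \<in> carrier A" and "f y < f x"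
      and alt: "(\<forall>n\<ge>1. real n * f x < real (n + 1) * f y) \<or>
        (\<forall>n\<ge>1. real (n + 1) * f x < real n * f y)"
      by (auto simp: anomalous_pair_def less nsum_closed nsum simp del: of_nat_add)
    from \<open>f y < f x\<close> have "0 < f x - f y" by simp
    then obtain n where n: "\<bar>f x\<bar> + \<bar>f y\<bar> < real n * (f x - f y)"
      using ex_less_of_nat_mult by blast
    then have "1 \<le> n" by (cases n) auto
    with alt n show False by (auto simp: algebra_simps)
  qed
  then show ?thesis
    using totally_ordered_semigroup_axioms by (auto simp: non_anomalous_semigroup_def)
qed

text \<open>Given a real \<open>t\<close>, the countable group \<open>\<int> + \<int>t\<close> can be copied into the infinite type of the
  terminal object, whatever the size of that type, and so it has an arrow to that object. Followed by the embedding of the terminal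
  object into the reals it fixes 1, hence it is the inclusion and \<open>t\<close> is in the image.\<close>

theorem terminal_object_surj:
  fixes R :: "'u osemigroup"
  assumes terminal: "nas_terminal R r" and f: "morphism R real_line f" "f r = 1"
  shows "f ` carrier R = UNIV"
proof -
  from terminal have R: "nas_object R r" by (simp add: nas_terminal_def)
  then interpret R: totally_ordered_semigroup R
    by (simp add: nas_object_def non_anomalous_semigroup_def)
  from R have r: "r \<in> carrier R" by (simp add: nas_object_def)
  have "inj (\<lambda>n. nsum R (Suc n) r)"
  proof (rule injI)
    fix m n assume "nsum R (Suc m) r = nsum R (Suc n) r"
    then have "real (Suc m) * f r = real (Suc n) * f r"
      using R.additive_nsum[of f r, OF morphism_real_line_add[OF f(1)] r]
      by (metis One_nat_def Suc_le_mono zero_le)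
    then show "m = n" using f(2) by simp
  qed
  then have "\<exists>i::nat \<Rightarrow> 'u. inj i" by blast
  then obtain i :: "nat \<Rightarrow> 'u" where i: "inj i" ..
  have "t \<in> f ` carrier R" for t
  proof -
    define S where "S = range (\<lambda>(p::int, q::int). of_int p + of_int q * t)"
    have "countable S" unfolding S_def by blast
    define j where "j = i \<circ> to_nat_on S"
    have j: "inj_on j S"
      unfolding j_def using i \<open>countable S\<close> by (intro comp_inj_on) (auto intro: inj_on_subset)
    define k where "k = inv_into S j"
    have jk: "k (j s) = s" if "s \<in> S" for s
      using j that by (simp add: k_def)
    have kj: "k u \<in> S" "j (k u) = u" if "u \<in> j ` S" for u
      using that by (auto simp: jk)
    have S_add: "s + s' \<in> S" if s: "s \<in> S" "s' \<in> S" for s s'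
    proof -
      from s obtain p q p' q' :: int where "s = of_int p + of_int q * t" "s' = of_int p' + of_int q' * t"
        by (auto simp: S_def)
      then have "s + s' = (\<lambda>(p::int, q::int). of_int p + of_int q * t) (p + p', q + q')"
        by (simp add: algebra_simps)
      then show ?thesis unfolding S_def by blast
    qed
    have S1: "1 \<in> S" and St: "t \<in> S"
      unfolding S_def by (rule image_eqI[of _ _ "(1, 0)"], auto, rule image_eqI[of _ _ "(0, 1)"], auto)
    define A :: "'u osemigroup" where
      "A = \<lparr>carrier = j ` S, sadd = (\<lambda>u v. j (k u + k v)), sless = (\<lambda>u v. k u < k v)\<rparr>"
    have A: "carrier A = j ` S" "u \<boxplus>\<^bsub>A\<^esub> v = j (k u + k v)" "u \<prec>\<^bsub>A\<^esub> v \<longleftrightarrow> k u < k v" for u v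
      by (simp_all add: A_def)
    have na: "non_anomalous_semigroup A"
    proof (rule non_anomalous_if_embeds_in_reals[where f = k])
      show "inj_on k (carrier A)" using kj(2) by (intro inj_on_inverseI[of _ j]) (simp add: A)
    qed (simp_all only: A imageI S_add kj jk)
    then interpret A: totally_ordered_semigroup A by (simp add: non_anomalous_semigroup_def)
    have k: "morphism A real_line k"
      unfolding morphism_real_line_iff A using kj(1) jk S_add by simp
    have j1: "j 1 \<in> carrier A" using S1 by (simp add: A)
    have "\<not> is_identity A (j 1)"
    proof
      assume "is_identity A (j 1)"
      then have "j 1 \<boxplus>\<^bsub>A\<^esub> j 1 = j 1" using j1 by (simp add: is_identity_def)
      then have "k (j 1 \<boxplus>\<^bsub>A\<^esub> j 1) = k (j 1)" by simp
      then show False using morphism_real_line_add[OF k j1 j1] S1 by (simp add: jk)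
    qed
    with na j1 have "nas_object A (j 1)" by (simp add: nas_object_def)
    with terminal obtain h where h: "nas_arrow A (j 1) R r h"
      unfolding nas_terminal_def by blast
    then have hR: "h u \<in> carrier R" if "u \<in> carrier A" for u
      using that by (auto simp: nas_arrow_def morphism_def positive_morphism_def
          negative_morphism_def additive_map_def)
    have "morphism A real_line (f \<circ> h)"
      using h f(1) unfolding nas_arrow_def morphism_real_line_iff
      by (auto simp: morphism_def positive_morphism_def negative_morphism_def additive_map_def
          Pi_iff)
    then have "(f \<circ> h) (j t) = k (j t)"
      by (rule A.real_morphism_unique[OF _ k j1])
        (use h f(2) S1 St in \<open>auto simp: nas_arrow_def A jk\<close>)
    then have "f (h (j t)) = t" using St by (simp add: jk)
    moreover have "h (j t) \<in> carrier R" using St by (intro hR) (simp add: A)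
    ultimately show ?thesis by (metis imageI)
  qed
  then show ?thesis by blast
qed

section \<open>Archimedean rings\<close>

lemma additive_part_simps [simp]:
  "carrier (additive_part F) = carrier F"
  "sadd (additive_part F) = add F"
  "sless (additive_part F) = rless F"
  by (simp_all add: additive_part_def)

text \<open>The Archimedean property is stated relative to some group identity, which can only be the zero
  of the ring.\<close>

lemma archimedean_ring_multiple_greater:
  assumes F: "archimedean_ring F"
    and pos: "x \<in> carrier F" "y \<in> carrier F" "rless F \<zero>\<^bsub>F\<^esub> x" "rless F \<zero>\<^bsub>F\<^esub> y"
  shows "\<exists>n\<ge>1. rless F x (nsum (additive_part F) n y)"
proof -
  interpret ring F using F by (simp add: archimedean_ring_def)
  from F obtain z where z: "group \<lparr>carrier = carrier F, monoid.mult = add F, one = z\<rparr>"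
    and arch: "\<forall>x\<in>carrier F. \<forall>y\<in>carrier F. rless F z x \<and> rless F z y \<longrightarrow>
      (\<exists>n\<ge>1. rless F x (nsum (additive_part F) n y))"
    unfolding archimedean_ring_def archimedean_group_def by auto
  interpret G: group "\<lparr>carrier = carrier F, monoid.mult = add F, one = z\<rparr>" by (rule z)
  have "z \<in> carrier F" using G.one_closed by simp
  then have "z = \<zero>\<^bsub>F\<^esub>" using G.l_one[of "\<zero>\<^bsub>F\<^esub>"] by simp
  with arch pos show ?thesis by blast
qed

text \<open>Since addition is commutative, \<open>nx = ny + nd\<close> with \<open>d = x - y\<close>. For \<open>x > y\<close> some multiple of \<open>d\<close>
  exceeds \<open>y\<close> and some multiple exceeds \<open>-x\<close>, which excludes the two kinds of anomalous pairs.\<close>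

lemma archimedean_ring_nas_object:
  assumes F: "archimedean_ring F"
  shows "nas_object (additive_part F) \<one>\<^bsub>F\<^esub>"
proof -
  interpret ring F using F by (simp add: archimedean_ring_def)
  interpret T: totally_ordered_semigroup "additive_part F"
    using F by (simp add: archimedean_ring_def archimedean_group_def)
  note T_mono = T.add_mono_right[simplified] T.add_mono_left[simplified]
  note T_trans = T.less_trans[simplified]
  let ?n = "nsum (additive_part F)"
  have nc: "?n n x \<in> carrier F" if "x \<in> carrier F" for n x
    using T.nsum_closed[of x n] that by simp
  have n_Suc: "?n (Suc n) x = ?n n x \<oplus>\<^bsub>F\<^esub> x" if "1 \<le> n" for n x
    using T.nsum_Suc[OF that] by simp
  have n_add: "?n n (x \<oplus>\<^bsub>F\<^esub> y) = ?n n x \<oplus>\<^bsub>F\<^esub> ?n n y"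
    if "x \<in> carrier F" "y \<in> carrier F" "1 \<le> n" for n x y
    using \<open>1 \<le> n\<close>
  proof (induction n rule: dec_induct)
    case (step n)
    then show ?case using that by (simp add: n_Suc nc a_ac)
  qed (simp add: T.nsum_1)
  have irrefl: "\<not> rless F x x" if "x \<in> carrier F" for x
    using T.less_irrefl that by simp
  have "\<not> anomalous_pair (additive_part F) x y" for x y
  proof
    assume "anomalous_pair (additive_part F) x y"
    then have x: "x \<in> carrier F" and y: "y \<in> carrier F" and yx: "rless F y x"
      and alt: "(\<forall>n\<ge>1. rless F (?n n x) (?n (Suc n) y)) \<or>
        (\<forall>n\<ge>1. rless F (?n (Suc n) x) (?n n y))"
      by (auto simp: anomalous_pair_def)
    define d where "d = x \<ominus>\<^bsub>F\<^esub> y"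
    have d: "d \<in> carrier F" and x_eq: "x = y \<oplus>\<^bsub>F\<^esub> d"
      using x y by (simp_all add: d_def minus_eq a_lcomm r_neg)
    have d_pos: "rless F \<zero>\<^bsub>F\<^esub> d"
      using T_mono(1)[OF y x a_inv_closed[OF y] yx] y by (simp add: d_def minus_eq r_neg)
    have nx: "?n n x = ?n n y \<oplus>\<^bsub>F\<^esub> ?n n d" if "1 \<le> n" for n
      unfolding x_eq using n_add y d that by blast
    from alt show False
    proof
      assume less: "\<forall>n\<ge>1. rless F (?n n x) (?n (Suc n) y)"
      then have "rless F x (y \<oplus>\<^bsub>F\<^esub> y)" using n_Suc[of 1 y] by fastforce
      then have yy: "rless F y (y \<oplus>\<^bsub>F\<^esub> y)" using T_trans[OF y x _ yx] y by simp
      have "rless F \<zero>\<^bsub>F\<^esub> y"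
        using T_mono(1)[OF _ _ a_inv_closed[OF y] yy] y by (simp add: r_neg a_assoc)
      then obtain n where n: "1 \<le> n" "rless F y (?n n d)"
        using archimedean_ring_multiple_greater[OF F y d] d_pos by blast
      have "rless F (?n (Suc n) y) (?n n x)"
        unfolding nx[OF n(1)] n_Suc[OF n(1)] using n y d nc by (intro T_mono(2)) auto
      with less n(1) show False
        using T_trans[of "?n n x" "?n (Suc n) y" "?n n x"] irrefl nc x y by blast
    next
      assume less: "\<forall>n\<ge>1. rless F (?n (Suc n) x) (?n n y)"
      then have "rless F (x \<oplus>\<^bsub>F\<^esub> x) y" using n_Suc[of 1 x] by fastforce
      then have xx: "rless F (x \<oplus>\<^bsub>F\<^esub> x) x" using T_trans[OF _ y x _ yx] x by simp
      let ?v = "\<ominus>\<^bsub>F\<^esub> x"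
      have xv: "rless F (x \<oplus>\<^bsub>F\<^esub> x \<oplus>\<^bsub>F\<^esub> ?v) (x \<oplus>\<^bsub>F\<^esub> ?v)"
        using T_mono(1)[OF _ _ a_inv_closed[OF x] xx] x by simp
      then have "rless F x \<zero>\<^bsub>F\<^esub>" using x by (simp add: r_neg a_assoc)
      then have "rless F \<zero>\<^bsub>F\<^esub> ?v"
        using T_mono(1)[of x "\<zero>\<^bsub>F\<^esub>" ?v] x by (simp add: r_neg)
      then obtain n where n: "1 \<le> n" "rless F ?v (?n n d)"
        using archimedean_ring_multiple_greater[OF F _ d] x d_pos by blast
      have "rless F (?v \<oplus>\<^bsub>F\<^esub> x) (?n n d \<oplus>\<^bsub>F\<^esub> x)"
        using n x d nc by (intro T_mono(1)) auto
      then have "rless F (?n n y \<oplus>\<^bsub>F\<^esub> \<zero>\<^bsub>F\<^esub>) (?n n y \<oplus>\<^bsub>F\<^esub> (?n n d \<oplus>\<^bsub>F\<^esub> x))"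
        using x y d nc by (intro T_mono(2)) (auto simp: l_neg)
      then have "rless F (?n n y) (?n (Suc n) x)"
        unfolding n_Suc[OF n(1)] nx[OF n(1)] using x y d nc by (simp add: a_assoc)
      with less n(1) show False
        using T_trans[of "?n n y" "?n (Suc n) x" "?n n y"] irrefl nc x y by blast
    qed
  qed
  moreover have "\<not> is_identity (additive_part F) \<one>\<^bsub>F\<^esub>"
  proof
    assume "is_identity (additive_part F) \<one>\<^bsub>F\<^esub>"
    then have "\<one>\<^bsub>F\<^esub> \<oplus>\<^bsub>F\<^esub> \<zero>\<^bsub>F\<^esub> = \<zero>\<^bsub>F\<^esub>" unfolding is_identity_def by auto
    with F show False by (simp add: archimedean_ring_def)
  qed
  ultimately show ?thesis
    using T.totally_ordered_semigroup_axioms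
    by (simp add: nas_object_def non_anomalous_semigroup_def)
qed

text \<open>Multiplication by a positive \<open>x\<close> preserves the order, so \<open>y \<mapsto> f (x y) / f x\<close> is a second
  morphism to the reals taking 1 to 1, and it has to be \<open>f\<close> itself.\<close>

theorem real_morphism_multiplicative:
  assumes F: "archimedean_ring F" and f: "morphism (additive_part F) real_line f"
    and f1: "f \<one>\<^bsub>F\<^esub> = 1" and x: "x \<in> carrier F" and y: "y \<in> carrier F"
  shows "f (x \<otimes>\<^bsub>F\<^esub> y) = f x * f y"
proof -
  interpret ring F using F by (simp add: archimedean_ring_def)
  interpret T: totally_ordered_semigroup "additive_part F"
    using F by (simp add: archimedean_ring_def archimedean_group_def)
  have add: "f (u \<oplus>\<^bsub>F\<^esub> v) = f u + f v" if "u \<in> carrier F" "v \<in> carrier F" for u v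
    using morphism_real_line_add[OF f] that by simp
  have f0: "f \<zero>\<^bsub>F\<^esub> = 0" using add[of "\<zero>\<^bsub>F\<^esub>" "\<zero>\<^bsub>F\<^esub>"] by simp
  have neg: "f (\<ominus>\<^bsub>F\<^esub> u) = - f u" if "u \<in> carrier F" for u
    using add[of u "\<ominus>\<^bsub>F\<^esub> u"] that by (simp add: r_neg f0)
  have pos: "f (u \<otimes>\<^bsub>F\<^esub> y) = f u * f y" if u: "u \<in> carrier F" and u0: "rless F \<zero>\<^bsub>F\<^esub> u" for u
  proof -
    have mono: "rless F (u \<otimes>\<^bsub>F\<^esub> v) (u \<otimes>\<^bsub>F\<^esub> w)"
      if v: "v \<in> carrier F" and w: "w \<in> carrier F" and "rless F v w" for v w
    proof -
      have "rless F \<zero>\<^bsub>F\<^esub> (w \<ominus>\<^bsub>F\<^esub> v)"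
        using T.add_mono_right[of v w "\<ominus>\<^bsub>F\<^esub> v"] that by (simp add: minus_eq r_neg)
      then have "rless F \<zero>\<^bsub>F\<^esub> (u \<otimes>\<^bsub>F\<^esub> (w \<ominus>\<^bsub>F\<^esub> v))"
        using F u u0 v w by (simp add: archimedean_ring_def)
      then have "rless F (u \<otimes>\<^bsub>F\<^esub> v \<oplus>\<^bsub>F\<^esub> \<zero>\<^bsub>F\<^esub>) (u \<otimes>\<^bsub>F\<^esub> v \<oplus>\<^bsub>F\<^esub> u \<otimes>\<^bsub>F\<^esub> (w \<ominus>\<^bsub>F\<^esub> v))"
        using T.add_mono_left[of "\<zero>\<^bsub>F\<^esub>" "u \<otimes>\<^bsub>F\<^esub> (w \<ominus>\<^bsub>F\<^esub> v)" "u \<otimes>\<^bsub>F\<^esub> v"] u v w by simp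
      moreover have "u \<otimes>\<^bsub>F\<^esub> v \<oplus>\<^bsub>F\<^esub> u \<otimes>\<^bsub>F\<^esub> (w \<ominus>\<^bsub>F\<^esub> v) = u \<otimes>\<^bsub>F\<^esub> w"
        using u v w a_lcomm[of v w "\<ominus>\<^bsub>F\<^esub> v"]
        by (simp add: r_distr[symmetric] minus_eq r_neg)
      ultimately show ?thesis using u v by simp
    qed
    have "u \<noteq> \<zero>\<^bsub>F\<^esub>" using T.less_irrefl[of u] u u0 by auto
    then have "f u \<noteq> 0"
      using inj_onD[OF T.real_morphism_inj[OF f], of u "\<zero>\<^bsub>F\<^esub>"] u f0 by auto
    have "morphism (additive_part F) real_line (\<lambda>v. f (u \<otimes>\<^bsub>F\<^esub> v) / f u)"
    proof -
      have "f (u \<otimes>\<^bsub>F\<^esub> (v \<oplus>\<^bsub>F\<^esub> w)) / f u = f (u \<otimes>\<^bsub>F\<^esub> v) / f u + f (u \<otimes>\<^bsub>F\<^esub> w) / f u"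
        if "v \<in> carrier F" "w \<in> carrier F" for v w
        using that u by (simp add: r_distr add add_divide_distrib)
      moreover have "f (u \<otimes>\<^bsub>F\<^esub> v) / f u < f (u \<otimes>\<^bsub>F\<^esub> w) / f u"
        if vw: "v \<in> carrier F" "w \<in> carrier F" "rless F v w" for v w
      proof -
        have c: "u \<otimes>\<^bsub>F\<^esub> v \<in> carrier F" "u \<otimes>\<^bsub>F\<^esub> w \<in> carrier F" using vw u by auto
        from f consider "\<forall>x\<in>carrier F. \<forall>y\<in>carrier F. rless F x y \<longrightarrow> f x < f y"
          | "\<forall>x\<in>carrier F. \<forall>y\<in>carrier F. rless F x y \<longrightarrow> f y < f x"
          by (auto simp: morphism_real_line_iff)
        then show ?thesis
        proof cases
          case 1
          then have "f \<zero>\<^bsub>F\<^esub> < f u" "f (u \<otimes>\<^bsub>F\<^esub> v) < f (u \<otimes>\<^bsub>F\<^esub> w)"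
            using u u0 c mono[OF vw] zero_closed by blast+
          with f0 show ?thesis by (simp add: divide_strict_right_mono)
        next
          case 2
          then have "f u < f \<zero>\<^bsub>F\<^esub>" "f (u \<otimes>\<^bsub>F\<^esub> w) < f (u \<otimes>\<^bsub>F\<^esub> v)"
            using u u0 c mono[OF vw] zero_closed by blast+
          with f0 show ?thesis by (simp add: divide_strict_right_mono_neg)
        qed
      qed
      ultimately show ?thesis by (simp add: morphism_real_line_iff)
    qed
    then have "f (u \<otimes>\<^bsub>F\<^esub> y) / f u = f y"
      using T.real_morphism_unique[OF _ f, of "\<lambda>v. f (u \<otimes>\<^bsub>F\<^esub> v) / f u" "\<one>\<^bsub>F\<^esub>" y]
        f1 u y \<open>f u \<noteq> 0\<close> by simp
    then show ?thesis using \<open>f u \<noteq> 0\<close> by (simp add: field_simps)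
  qed
  consider "rless F \<zero>\<^bsub>F\<^esub> x" | "x = \<zero>\<^bsub>F\<^esub>" | "rless F x \<zero>\<^bsub>F\<^esub>"
    using T.trichotomy[of x "\<zero>\<^bsub>F\<^esub>"] x by auto
  then show ?thesis
  proof cases
    case 1
    then show ?thesis using pos x by blast
  next
    case 2
    then show ?thesis using y by (simp add: f0)
  next
    case 3
    then have "rless F \<zero>\<^bsub>F\<^esub> (\<ominus>\<^bsub>F\<^esub> x)"
      using T.add_mono_right[of x "\<zero>\<^bsub>F\<^esub>" "\<ominus>\<^bsub>F\<^esub> x"] x by (simp add: r_neg)
    then have "f ((\<ominus>\<^bsub>F\<^esub> x) \<otimes>\<^bsub>F\<^esub> y) = f (\<ominus>\<^bsub>F\<^esub> x) * f y" using pos x by simp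
    then show ?thesis using x y by (simp add: l_minus neg)
  qed
qed


section \<open>The product on a copy of the real line\<close>

locale real_copy = totally_ordered_semigroup R for R :: "'u osemigroup" (structure) +
  fixes e :: 'u and \<phi> :: "'u \<Rightarrow> real"
  assumes e: "e \<in> carrier R"
    and morph: "morphism R real_line \<phi>"
    and \<phi>_e: "\<phi> e = 1"
    and bij: "bij_betw \<phi> (carrier R) UNIV"
begin

definition \<psi> :: "real \<Rightarrow> 'u" where
  "\<psi> = inv_into (carrier R) \<phi>"

definition real_mult :: "'u \<Rightarrow> 'u \<Rightarrow> 'u" where
  "real_mult = (\<lambda>x\<in>carrier R. \<lambda>y\<in>carrier R. \<psi> (\<phi> x * \<phi> y))"

lemma \<psi>_closed [simp]: "\<psi> t \<in> carrier R"
  unfolding \<psi>_def using bij by (auto simp: bij_betw_def intro: inv_into_into)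

lemma \<phi>_\<psi> [simp]: "\<phi> (\<psi> t) = t"
  unfolding \<psi>_def using bij by (auto simp: bij_betw_def intro: f_inv_into_f)

lemma \<psi>_\<phi> [simp]: "x \<in> carrier R \<Longrightarrow> \<psi> (\<phi> x) = x"
  unfolding \<psi>_def using bij by (auto simp: bij_betw_def)

lemma \<phi>_add [simp]: "\<lbrakk>x \<in> carrier R; y \<in> carrier R\<rbrakk> \<Longrightarrow> \<phi> (x \<boxplus> y) = \<phi> x + \<phi> y"
  using morph by (rule morphism_real_line_add)

lemma \<phi>_eq_iff: "\<lbrakk>x \<in> carrier R; y \<in> carrier R\<rbrakk> \<Longrightarrow> x = y \<longleftrightarrow> \<phi> x = \<phi> y"
  by (metis \<psi>_\<phi>)

lemma neutral_eq: "neutral R = \<psi> 0"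
  unfolding neutral_def
proof (rule the_equality)
  show "is_identity R (\<psi> 0)"
    by (auto simp: is_identity_def \<phi>_eq_iff closed)
  fix z assume "is_identity R z"
  then have z: "z \<in> carrier R" "z \<boxplus> z = z" by (auto simp: is_identity_def)
  then have "\<phi> z + \<phi> z = \<phi> z" using \<phi>_add by metis
  then show "z = \<psi> 0" using z by (simp add: \<phi>_eq_iff)
qed

lemma oriented_simps [simp]:
  "carrier (oriented R e) = carrier R" "sadd (oriented R e) = sadd R"
  by (simp_all add: oriented_def dual_def)

text \<open>Whatever the sign of \<open>\<phi>\<close>, the orientation chosen by \<open>e\<close> is the one transported from the reals,
  because \<open>\<phi> e = 1\<close> is positive.\<close>

lemma oriented_less_iff:
  assumes "x \<in> carrier R" "y \<in> carrier R"
  shows "x \<prec>\<^bsub>oriented R e\<^esub> y \<longleftrightarrow> \<phi> x < \<phi> y"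
proof -
  from morph consider "\<forall>x\<in>carrier R. \<forall>y\<in>carrier R. x \<prec> y \<longrightarrow> \<phi> x < \<phi> y"
    | "\<forall>x\<in>carrier R. \<forall>y\<in>carrier R. x \<prec> y \<longrightarrow> \<phi> y < \<phi> x"
    by (auto simp: morphism_real_line_iff)
  then show ?thesis
  proof cases
    case 1
    then have iff: "x \<prec> y \<longleftrightarrow> \<phi> x < \<phi> y" if "x \<in> carrier R" "y \<in> carrier R" for x y
      using trichotomy[of x y] that by fastforce
    have "neutral R \<prec> e" using iff[of "\<psi> 0" e] e by (simp add: neutral_eq \<phi>_e)
    then show ?thesis using iff assms by (simp add: oriented_def)
  next
    case 2
    then have iff: "x \<prec> y \<longleftrightarrow> \<phi> y < \<phi> x" if "x \<in> carrier R" "y \<in> carrier R" for x y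
      using trichotomy[of x y] that by fastforce
    have "\<not> neutral R \<prec> e" using iff[of "\<psi> 0" e] e by (simp add: neutral_eq \<phi>_e)
    then show ?thesis using iff assms by (simp add: oriented_def dual_def)
  qed
qed

lemma with_product_simps [simp]:
  "carrier (with_product R e m) = carrier R"
  "monoid.mult (with_product R e m) = m"
  "one (with_product R e m) = e"
  "zero (with_product R e m) = \<psi> 0"
  "add (with_product R e m) = sadd R"
  "rless (with_product R e m) = sless (oriented R e)"
  by (simp_all add: with_product_def neutral_eq)

lemma additive_part_with_product: "additive_part (with_product R e m) = oriented R e"
  by (simp add: additive_part_def with_product_def oriented_def dual_def)

lemma archimedean_group_oriented: "archimedean_group (oriented R e)"
proof -
  have "non_anomalous_semigroup (oriented R e)"
    using bij by (intro non_anomalous_if_embeds_in_reals[where f = \<phi>])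
      (auto simp: oriented_less_iff closed bij_betw_def)
  then interpret O: totally_ordered_semigroup "oriented R e"
    by (simp add: non_anomalous_semigroup_def)
  have nsum: "nsum (oriented R e) n x \<in> carrier R \<and> \<phi> (nsum (oriented R e) n x) = real n * \<phi> x"
    if "x \<in> carrier R" "1 \<le> n" for n x
    using O.additive_nsum[of \<phi> x n] O.nsum_closed[of x n] that by simp
  have large: "\<exists>n\<ge>1. c < real n * d" if "0 < d" for c d :: real
  proof -
    obtain n where "max c 0 < real n * d" using ex_less_of_nat_mult \<open>0 < d\<close> by blast
    then have "1 \<le> n" "c < real n * d" by (cases n, auto)
    then show ?thesis by blast
  qed
  have "group \<lparr>carrier = carrier R, monoid.mult = sadd R, one = \<psi> 0\<rparr>"
  proof (rule groupI, goal_cases)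
    case (5 x)
    then show ?case by (intro bexI[of _ "\<psi> (- \<phi> x)"]) (simp_all add: \<phi>_eq_iff closed)
  qed (simp_all add: \<phi>_eq_iff closed)
  moreover have "\<exists>n\<ge>1. x \<prec>\<^bsub>oriented R e\<^esub> nsum (oriented R e) n y"
    if "x \<in> carrier R" "y \<in> carrier R" "\<psi> 0 \<prec>\<^bsub>oriented R e\<^esub> y" for x y
    using large[of "\<phi> y" "\<phi> x"] that nsum by (auto simp: oriented_less_iff)
  moreover have "\<exists>n\<ge>1. nsum (oriented R e) n y \<prec>\<^bsub>oriented R e\<^esub> x"
    if "x \<in> carrier R" "y \<in> carrier R" "y \<prec>\<^bsub>oriented R e\<^esub> \<psi> 0" for x y
    using large[of "- \<phi> y" "- \<phi> x"] that nsum by (auto simp: oriented_less_iff)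
  ultimately show ?thesis
    unfolding archimedean_group_def using O.totally_ordered_semigroup_axioms
    by (auto intro!: exI[of _ "\<psi> 0"])
qed

lemma is_product_real_mult: "is_product R e real_mult"
proof -
  let ?K = "with_product R e real_mult"
  have mult: "real_mult x y = \<psi> (\<phi> x * \<phi> y)" if "x \<in> carrier R" "y \<in> carrier R" for x y
    using that by (simp add: real_mult_def)
  have "ring ?K"
  proof (rule ringI)
    show "abelian_group ?K"
    proof (rule abelian_groupI, goal_cases)
      case (6 x)
      then show ?case by (intro bexI[of _ "\<psi> (- \<phi> x)"]) (simp_all add: \<phi>_eq_iff closed)
    qed (simp_all add: \<phi>_eq_iff closed)
    show "monoid ?K"
      by (rule monoidI) (simp_all add: mult e \<phi>_e \<phi>_eq_iff)
  qed (simp_all add: mult closed \<phi>_eq_iff algebra_simps)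
  moreover have "e \<noteq> \<psi> 0" using e by (simp add: \<phi>_eq_iff \<phi>_e)
  ultimately have "archimedean_ring ?K"
    using archimedean_group_oriented
    by (simp add: archimedean_ring_def additive_part_with_product oriented_less_iff mult)
  then show ?thesis
    by (simp add: is_product_def real_mult_def)
qed

lemma \<phi>_morphism_oriented: "morphism (oriented R e) real_line \<phi>"
  using morph by (simp add: oriented_def morphism_real_line_dual)

lemma product_eq:
  assumes m: "is_product R e m" and "x \<in> carrier R" "y \<in> carrier R"
  shows "\<phi> (m x y) = \<phi> x * \<phi> y"
  using real_morphism_multiplicative[of "with_product R e m" \<phi> x y] assms \<phi>_morphism_oriented
  by (simp add: is_product_def additive_part_with_product \<phi>_e)

lemma product_closed:
  "\<lbrakk>is_product R e m; x \<in> carrier R; y \<in> carrier R\<rbrakk> \<Longrightarrow> m x y \<in> carrier R"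
  unfolding is_product_def by (meson PiE_mem)

lemma is_product_unique:
  assumes m: "is_product R e m"
  shows "m = real_mult"
proof (rule PiE_ext)
  show "m \<in> carrier R \<rightarrow>\<^sub>E (carrier R \<rightarrow>\<^sub>E carrier R)"
    "real_mult \<in> carrier R \<rightarrow>\<^sub>E (carrier R \<rightarrow>\<^sub>E carrier R)"
    using m is_product_real_mult by (simp_all add: is_product_def)
  fix x assume x: "x \<in> carrier R"
  show "m x = real_mult x"
  proof (rule PiE_ext)
    show "m x \<in> carrier R \<rightarrow>\<^sub>E carrier R" "real_mult x \<in> carrier R \<rightarrow>\<^sub>E carrier R"
      using m is_product_real_mult x by (auto simp: is_product_def dest: PiE_mem)
    fix y assume "y \<in> carrier R"
    with x m is_product_real_mult show "m x y = real_mult x y"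
      by (simp add: \<phi>_eq_iff product_eq product_closed)
  qed
qed

lemma product_Units:
  assumes m: "is_product R e m" and x: "x \<in> carrier R" "x \<noteq> \<psi> 0"
  shows "x \<in> Units (with_product R e m)"
proof -
  have "\<phi> x \<noteq> 0" using x by (simp add: \<phi>_eq_iff)
  then have "m (\<psi> (1 / \<phi> x)) x = e" "m x (\<psi> (1 / \<phi> x)) = e"
    using m x e by (simp_all add: \<phi>_eq_iff product_eq product_closed \<phi>_e)
  then show ?thesis using x by (auto simp: Units_def intro!: bexI[of _ "\<psi> (1 / \<phi> x)"])
qed

lemma archimedean_field_product:
  "is_product R e m \<Longrightarrow> archimedean_field (with_product R e m)"
  using product_Units by (auto simp: archimedean_field_def is_product_def)

lemma field_product:
  assumes m: "is_product R e m"
  shows "field (with_product R e m)"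
proof -
  let ?K = "with_product R e m"
  interpret K: ring ?K using m by (simp add: is_product_def archimedean_ring_def)
  interpret K: cring ?K
  proof
    fix x y assume "x \<in> carrier ?K" "y \<in> carrier ?K"
    then show "x \<otimes>\<^bsub>?K\<^esub> y = y \<otimes>\<^bsub>?K\<^esub> x"
      using m by (simp add: \<phi>_eq_iff product_eq product_closed)
  qed
  have "e \<noteq> \<psi> 0" using e by (simp add: \<phi>_eq_iff \<phi>_e)
  have "\<psi> 0 \<notin> Units ?K"
  proof
    assume "\<psi> 0 \<in> Units ?K"
    then obtain y where "y \<in> carrier R" "m y (\<psi> 0) = e" by (auto simp: Units_def)
    with m have "\<phi> e = \<phi> y * \<phi> (\<psi> 0)" using product_eq[OF m, of y "\<psi> 0"] by simp
    then show False by (simp add: \<phi>_e)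
  qed
  moreover have "Units ?K \<subseteq> carrier R" by (auto simp: Units_def)
  ultimately have "Units ?K = carrier ?K - {\<zero>\<^bsub>?K\<^esub>}"
    using product_Units[OF m] by auto
  then show ?thesis by (rule K.cring_fieldI)
qed

lemma af_terminal_product:
  assumes m: "is_product R e m"
  shows "af_terminal TYPE('v) (with_product R e m)"
  unfolding af_terminal_def
proof (intro conjI allI impI)
  let ?K = "with_product R e m"
  show "archimedean_field ?K" using m by (rule archimedean_field_product)
  fix F :: "'v oring" assume "archimedean_field F"
  then have F: "archimedean_ring F" by (simp add: archimedean_field_def)
  interpret ring F using F by (simp add: archimedean_ring_def)
  interpret T: totally_ordered_semigroup "additive_part F"
    using F by (simp add: archimedean_ring_def archimedean_group_def)
  from real_embedding_exists[OF archimedean_ring_nas_object[OF F]]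
  obtain f where f: "morphism (additive_part F) real_line f" and f1: "f \<one>\<^bsub>F\<^esub> = 1" by blast
  have f_add: "f (x \<oplus>\<^bsub>F\<^esub> y) = f x + f y" if "x \<in> carrier F" "y \<in> carrier F" for x y
    using morphism_real_line_add[OF f] that by simp
  note f_mult = real_morphism_multiplicative[OF F f f1]
  show "\<exists>!g. af_arrow F ?K g"
  proof
    let ?g = "\<lambda>x\<in>carrier F. \<psi> (f x)"
    have "?g \<in> ring_hom F ?K"
      by (rule ring_hom_memI)
        (use m in \<open>simp_all add: \<phi>_eq_iff product_eq product_closed closed e \<phi>_e f1 f_add f_mult\<close>)
    moreover have "morphism (additive_part F) (oriented R e) ?g"
      using f by (simp add: morphism_def[of _ "oriented R e"] positive_morphism_def
          negative_morphism_def additive_map_def morphism_real_line_iff oriented_less_iff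
          \<phi>_eq_iff closed)
    ultimately show "af_arrow F ?K ?g"
      by (simp add: af_arrow_def additive_part_with_product)
    fix g assume "af_arrow F ?K g"
    then have ext: "g \<in> extensional (carrier F)" and hom: "g \<in> ring_hom F ?K"
      and g: "morphism (additive_part F) (oriented R e) g"
      by (simp_all add: af_arrow_def additive_part_with_product)
    have gc: "g x \<in> carrier R" if "x \<in> carrier F" for x
      using ring_hom_closed[OF hom that] by simp
    have "morphism (additive_part F) real_line (\<phi> \<circ> g)"
      using g gc by (auto simp: morphism_def[of _ "oriented R e"] positive_morphism_def
          negative_morphism_def additive_map_def morphism_real_line_iff oriented_less_iff)
    moreover have "(\<phi> \<circ> g) \<one>\<^bsub>F\<^esub> = 1" using ring_hom_one[OF hom] by (simp add: \<phi>_e)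
    ultimately have "\<phi> (g x) = f x" if "x \<in> carrier F" for x
      using T.real_morphism_unique[OF _ f, of "\<phi> \<circ> g" "\<one>\<^bsub>F\<^esub>" x] f1 that by simp
    then show "g = ?g"
      using ext gc by (intro extensionalityI[of _ "carrier F"]) (auto simp: \<phi>_eq_iff)
  qed
qed

end

lemma terminal_object_real_copy:
  assumes terminal: "nas_terminal R r" and e: "e \<in> carrier R" "\<not> is_identity R e"
  obtains \<phi> where "real_copy R e \<phi>"
proof -
  from terminal have R: "nas_object R r" by (simp add: nas_terminal_def)
  then interpret totally_ordered_semigroup R
    by (simp add: nas_object_def non_anomalous_semigroup_def)
  from real_embedding_exists[OF R] obtain f where f: "morphism R real_line f" and fr: "f r = 1"
    by blast
  have surj: "f ` carrier R = UNIV"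
    by (rule terminal_object_surj[OF terminal f fr])
  have inj: "inj_on f (carrier R)" by (rule real_morphism_inj[OF f])
  have fe: "f e \<noteq> 0"
  proof
    assume "f e = 0"
    then have "f (e \<boxplus>\<^bsub>R\<^esub> e) = f e" using morphism_real_line_add[OF f] e by simp
    then have "e \<boxplus>\<^bsub>R\<^esub> e = e" using inj_onD[OF inj] closed e by blast
    with e show False using idempotent_imp_identity by blast
  qed
  have "real_copy R e (\<lambda>x. f x / f e)"
  proof
    \<comment> \<open>a negative \<open>f e\<close> exchanges positive and negative morphisms\<close>
    show "morphism R real_line (\<lambda>x. f x / f e)"
    proof (cases "0 < f e")
      case True
      with f show ?thesis by (auto simp: morphism_real_line_iff field_simps)
    next
      case False
      with fe have "f e < 0" by simp
      with f show ?thesis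
        by (auto simp: morphism_real_line_iff field_simps)
    qed
    show "bij_betw (\<lambda>x. f x / f e) (carrier R) UNIV"
      unfolding bij_betw_def
    proof
      show "inj_on (\<lambda>x. f x / f e) (carrier R)" using inj fe by (auto simp: inj_on_def)
      have "t \<in> (\<lambda>x. f x / f e) ` carrier R" for t
      proof -
        obtain x where "x \<in> carrier R" "f x = t * f e" using surj by (metis UNIV_I imageE)
        with fe show ?thesis by (intro image_eqI[of _ _ x]) auto
      qed
      then show "(\<lambda>x. f x / f e) ` carrier R = UNIV" by blast
    qed
  qed (use e fe in auto)
  then show ?thesis by (rule that)
qed

theorem mainTheorem4:
  fixes R :: "'u osemigroup" and r :: 'u
  assumes "nas_terminal R r"
  shows "\<forall>e\<in>carrier R. \<not> is_identity R e \<longrightarrow>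
    (\<exists>!m. is_product R e m) \<and>
    (\<forall>m. is_product R e m \<longrightarrow>
       field (with_product R e m) \<and> archimedean_field (with_product R e m) \<and>
       af_terminal TYPE('v) (with_product R e m))"
proof (intro ballI impI)
  fix e assume "e \<in> carrier R" "\<not> is_identity R e"
  then obtain \<phi> where "real_copy R e \<phi>"
    by (rule terminal_object_real_copy[OF assms])
  then interpret real_copy R e \<phi> .
  show "(\<exists>!m. is_product R e m) \<and>
    (\<forall>m. is_product R e m \<longrightarrow>
       field (with_product R e m) \<and> archimedean_field (with_product R e m) \<and>
       af_terminal TYPE('v) (with_product R e m))"
  proof (intro conjI allI impI)
    show "\<exists>!m. is_product R e m"
      using is_product_real_mult is_product_unique by (rule ex1I)
  qed (fact field_product archimedean_field_product af_terminal_product)+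
qed

end
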